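(* Fix $f(t,z)=\sum_{i=0}^d a_i(t)z^i$ on $\Delta\times\mathbb{C}$ with $a_i$ holomorphic in $\Delta$, $a_d(0)\neq0$, $d\ge2$. There is a constant $\lambda_2=\lambda_2(f)>0$ such that for every fixed $\lambda$ with $0<|\lambda|<\lambda_2$, the map $P(t,z)=(\lambda t,f(t,z))$ has the following property. Let $\Delta_0\subset\{t=t_0\}$ be a wandering vertical Fatou disk of $P$ centered at $x_0=(t_0,z_0)$, let $x_n=(t_n,z_n)=P^n(x_0)$ and $\Delta_n=P^n(\Delta_0)$ for $n\ge1$, and let $\rho_n=\rho(z_n,\pi_2(\Delta_n))$. Then $$\lim_{n\to\infty}\frac{|\lambda|^n}{\rho_n}=0 .$$
   Context: Setting. $\Delta\subset\mathbb{C}$ is a disk centered at $0$; for $0<|\lambda|<1$, $P(t,z)=(\lambda t,f(t,z))$ maps $\Delta\times\mathbb{C}$ to itself. The disk $\Delta$ is small enough that there is $R>0$ with $|f(t,z)|\ge2|z|$ for all $t\in\Delta$, $|z|>R$. Write $p(z)=f(0,z)$ and $\pi_2(t,z)=z$. $F(P)$ is the largest open subset of $\Delta\times\mathbb{C}$ on which $\{P^n\}_{n\ge0}$ is normal (locally uniform divergence to infinity being allowed for limits); its connected components are the Fatou components of $P$. A Fatou component of $P$ is bulging if it contains $\{0\}\times U$ for some Fatou component $U$ of $p$. A vertical disk is a subset of a fiber $\{t=t_0\}$, $t_0\in\Delta$, whose image under $\pi_2$ is a disk in $\mathbb{C}$; it is a vertical Fatou disk if the restriction of $\{P^n\}_{n\ge0}$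 to it is a normal family. A vertical Fatou disk is called wandering if none of its forward images $P^n(\cdot)$ intersects a bulging Fatou component. Inradius. For a domain $U\subset\mathbb{C}$ and $z\in U$, $\rho(z,U)=\sup\{r>0: D(z,r)\subset U\}$, where $D(z,r)$ is the disk centered at $z$ of radius $r$. *)

theory Defs
  imports "HOL-Complex_Analysis.Complex_Analysis"
begin

definition diverges_loc_uniformly_on ::
  "'a::topological_space set \<Rightarrow> (nat \<Rightarrow> 'a \<Rightarrow> 'b::real_normed_vector) \<Rightarrow> bool" where
  "diverges_loc_uniformly_on S g \<longleftrightarrow>
     (\<forall>K. compact K \<and> K \<subseteq> S \<longrightarrow> (\<forall>B. \<forall>\<^sub>F n in sequentially. \<forall>x\<in>K. norm (g n x) > B))"

definition converges_loc_uniformly_on ::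
  "'a::topological_space set \<Rightarrow> (nat \<Rightarrow> 'a \<Rightarrow> 'b::real_normed_vector) \<Rightarrow> bool" where
  "converges_loc_uniformly_on S g \<longleftrightarrow>
     (\<exists>h. \<forall>K. compact K \<and> K \<subseteq> S \<longrightarrow> uniform_limit K g h sequentially)"

text \<open>The alternative between convergence and divergence is taken on each connected component
  of \<open>S\<close> separately. This makes normality a local property, so that there is a largest open set
  on which a given family is normal. The definition is meant for locally compact \<open>S\<close> (open sets
  and vertical disks), where local uniformity can be tested on compact subsets.\<close>

definition normal_family_on ::
  "'a::topological_space set \<Rightarrow> ('a \<Rightarrow> 'b::real_normed_vector) set \<Rightarrow> bool" where
  "normal_family_on S \<F> \<longleftrightarrow>
     (\<forall>g::nat \<Rightarrow> 'a \<Rightarrow> 'b. range g \<subseteq> \<F> \<longrightarrow>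
        (\<exists>r. strict_mono r \<and>
             (\<forall>C\<in>components S. converges_loc_uniformly_on C (g \<circ> r) \<or>
                               diverges_loc_uniformly_on C (g \<circ> r))))"

definition iterates :: "('a \<Rightarrow> 'a) \<Rightarrow> ('a \<Rightarrow> 'a) set" where
  "iterates g = range (\<lambda>n. g ^^ n)"

definition Fatou_set :: "'a::real_normed_vector set \<Rightarrow> ('a \<Rightarrow> 'a) \<Rightarrow> 'a set" where
  "Fatou_set X g = \<Union>{W. open W \<and> W \<subseteq> X \<and> normal_family_on W (iterates g)}"

definition Fatou_components :: "'a::real_normed_vector set \<Rightarrow> ('a \<Rightarrow> 'a) \<Rightarrow> 'a set set" where
  "Fatou_components X g = components (Fatou_set X g)"

definition skew ::
  "complex \<Rightarrow> (complex \<Rightarrow> complex \<Rightarrow> complex) \<Rightarrow> complex \<times> complex \<Rightarrow> complex \<times> complex" where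
  "skew lam f = (\<lambda>(t, z). (lam * t, f t z))"

text \<open>The Fatou components of \<open>f 0\<close> include the basin of infinity.\<close>

definition bulging ::
  "complex set \<Rightarrow> complex \<Rightarrow> (complex \<Rightarrow> complex \<Rightarrow> complex) \<Rightarrow> (complex \<times> complex) set \<Rightarrow> bool" where
  "bulging \<Delta> lam f \<Omega> \<longleftrightarrow>
     \<Omega> \<in> Fatou_components (\<Delta> \<times> UNIV) (skew lam f) \<and>
     (\<exists>U \<in> Fatou_components UNIV (f 0). {0} \<times> U \<subseteq> \<Omega>)"

definition vertical_disk_centered ::
  "complex set \<Rightarrow> complex \<times> complex \<Rightarrow> (complex \<times> complex) set \<Rightarrow> bool" where
  "vertical_disk_centered \<Delta> x D \<longleftrightarrow>
     fst x \<in> \<Delta> \<and> D \<subseteq> {fst x} \<times> UNIV \<and> (\<exists>r>0. snd ` D = ball (snd x) r)"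

definition vertical_Fatou_disk_centered ::
  "complex set \<Rightarrow> complex \<Rightarrow> (complex \<Rightarrow> complex \<Rightarrow> complex) \<Rightarrow>
   complex \<times> complex \<Rightarrow> (complex \<times> complex) set \<Rightarrow> bool" where
  "vertical_Fatou_disk_centered \<Delta> lam f x D \<longleftrightarrow>
     vertical_disk_centered \<Delta> x D \<and> normal_family_on D (iterates (skew lam f))"

definition wandering ::
  "complex set \<Rightarrow> complex \<Rightarrow> (complex \<Rightarrow> complex \<Rightarrow> complex) \<Rightarrow> (complex \<times> complex) set \<Rightarrow> bool" where
  "wandering \<Delta> lam f D \<longleftrightarrow>
     (\<forall>n \<Omega>. bulging \<Delta> lam f \<Omega> \<longrightarrow> (skew lam f ^^ n) ` D \<inter> \<Omega> = {})"

text \<open>A real supremum: only meaningful when \<open>U\<close> contains a disk around \<open>z\<close> and is not the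
  whole plane, as is the case for bounded open \<open>U\<close> containing \<open>z\<close>.\<close>

definition inradius :: "complex \<Rightarrow> complex set \<Rightarrow> real" where
  "inradius z U = Sup {r. r > 0 \<and> ball z r \<subseteq> U}"

end

theory Submission
  imports Defs "HOL-Computational_Algebra.Fundamental_Theorem_Algebra"
begin

text \<open>Let \<open>\<rho> n\<close> be the inradii and \<open>G n = - ln (\<rho> n / R)\<close>. One step of the map changes \<open>G\<close> by at most
  \<open>- ln\<close> of the vertical derivative, or alternatively multiplies it by \<open>d\<close>, up to constants.
  For small \<open>|lam|\<close> the vertical coordinates stay, from time \<open>N\<close> to time \<open>2 d^d N\<close>, exponentially
  close to an orbit of \<open>p = f 0\<close>. A wandering disk avoids the basin of infinity and the
  superattracting basins. By a lemma of Denker, Przytycki and Urbanski, along an orbit of length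
  \<open>n\<close> the product of the distances to a nonperiodic critical point, with one factor removed,
  is at least \<open>th ^ n\<close> with a constant \<open>th > 0\<close>. So at all but at most \<open>d\<close> times in the window
  the derivative bound applies with total loss \<open>O(N)\<close>, and the exceptional times cost a factor \<open>d^d\<close>
  at most. Since the window is longer than its starting time by twice this factor, iterating
  gives \<open>G n \<le> Lam * n\<close> eventually, where \<open>Lam\<close> does not depend on \<open>lam\<close>; take \<open>|lam| < exp (- Lam)\<close>.\<close>

section \<open>Polynomial images of disks\<close>

text \<open>The power bound holds at every step, but alone it only gives growth of \<open>G\<close>
  like \<open>d ^ n\<close>; the derivative bound is worthless near critical points. Each critical
  point may cause one bad passage in every window, so windows of bounded length would still compound
  \<open>d ^ d\<close> exponentially in \<open>n\<close>. With geometrically growing windows only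
  about \<open>ln n\<close> such factors occur, and the length of the windows outweighs them in
  \<open>G n / n\<close>. Long windows are affordable because shadowing restarts: each window is
  compared with a fresh orbit of \<open>f 0\<close> from \<open>z N\<close>, where the fiber
  parameter already has size of order \<open>norm lam ^ N\<close>. The error is amplified over the
  window at an exponential rate in \<open>N\<close> that depends on \<open>f\<close> only, and
  \<open>norm lam\<close> has to beat this rate. Hence no constant chosen before \<open>lam2\<close>
  may depend on \<open>lam\<close>. At periodic critical points no product bound can hold, since
  orbits may approach them superexponentially; there the wandering hypothesis enters. A bulging
  component must contain all of \<open>{0} \<times> U\<close>, so it is not enough to find a trap:
  the whole Fatou component \<open>U\<close> has to lie in the corresponding basin.\<close>

text \<open>The second bound is the estimate of the logarithmic derivative, a sum of
  \<open>size A\<close> terms of modulus at most \<open>1 / r\<close>, with denominators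
  cleared.\<close>

lemma prod_mset_linear_factors_bounds:
  fixes A :: "complex multiset"
  assumes "\<And>w. w \<in># A \<Longrightarrow> r \<le> norm (z - w)" and r: "r > 0"
  shows "r ^ size A \<le> norm (poly (\<Prod>w\<in>#A. [:-w,1:]) z)"
    and "norm (poly (pderiv (\<Prod>w\<in>#A. [:-w,1:])) z) * r
           \<le> size A * norm (poly (\<Prod>w\<in>#A. [:-w,1:]) z)"
  using assms(1)
proof (induction A)
  case empty
  { case 1 show ?case by simp }
  { case 2 show ?case by (simp add: pderiv_1) }
next
  case (add x A)
  { case 1
    from 1 have hx: "r \<le> norm (z - x)" by simp
    from 1 have IH: "r ^ size A \<le> norm (poly (\<Prod>w\<in>#A. [:-w,1:]) z)"
      using add.IH(1) by simp
    have "r * r ^ size A \<le> norm (z - x) * norm (poly (\<Prod>w\<in>#A. [:-w,1:]) z)"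
      using hx IH r by (intro mult_mono) auto
    moreover have "norm (poly ([:-x,1:] * (\<Prod>w\<in>#A. [:-w,1:])) z)
        = norm (z - x) * norm (poly (\<Prod>w\<in>#A. [:-w,1:]) z)"
      unfolding poly_mult norm_mult by simp
    ultimately show ?case by simp }
  { case 2
    from 2 have hx: "r \<le> norm (z - x)" by simp
    let ?Q = "\<Prod>w\<in>#A. [:-w,1:]"
    from 2 have IH: "norm (poly (pderiv ?Q) z) * r \<le> size A * norm (poly ?Q z)"
      using add.IH(2) by simp
    have eq: "poly (pderiv ([:-x,1:] * ?Q)) z = poly ?Q z + (z - x) * poly (pderiv ?Q) z"
      by (simp only: pderiv_mult) (simp add: pderiv_pCons algebra_simps)
    have "norm (poly (pderiv ([:-x,1:] * ?Q)) z) * r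
        \<le> (norm (poly ?Q z) + norm (z - x) * norm (poly (pderiv ?Q) z)) * r"
      unfolding eq using r by (intro mult_right_mono) (auto intro: norm_triangle_le simp: norm_mult)
    also have "\<dots> = norm (poly ?Q z) * r + norm (z - x) * (norm (poly (pderiv ?Q) z) * r)"
      by (simp add: algebra_simps)
    also have "\<dots> \<le> norm (poly ?Q z) * norm (z - x) + norm (z - x) * (size A * norm (poly ?Q z))"
      using hx IH by (intro add_mono mult_left_mono) auto
    also have "\<dots> = size (add_mset x A) * (norm (z - x) * norm (poly ?Q z))"
      by (simp add: algebra_simps)
    also have "norm (z - x) * norm (poly ?Q z) = norm (poly ([:-x,1:] * ?Q) z)"
      unfolding poly_mult norm_mult by simp
    finally show ?case by simp }
qed

text \<open>If \<open>v\<close> is omitted on the ball, all roots of \<open>q - [:v:]\<close> have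
  distance at least \<open>r\<close> from \<open>z\<close>, and the factorization bounds
  \<open>dist (poly q z) v\<close> from below. The first radius never degenerates; the second is
  linear in \<open>r\<close> but vanishes at critical points.\<close>

lemma poly_image_ball:
  fixes q :: "complex poly"
  assumes d: "degree q > 0" and r: "r > 0"
  shows "ball (poly q z) (norm (lead_coeff q) * r ^ degree q) \<subseteq> poly q ` ball z r"
    and "ball (poly q z) (norm (poly (pderiv q) z) * r / degree q) \<subseteq> poly q ` ball z r"
proof -
  have key: "norm (lead_coeff q) * r ^ degree q \<le> dist (poly q z) v \<and>
        norm (poly (pderiv q) z) * r / degree q \<le> dist (poly q z) v"
    if v: "v \<notin> poly q ` ball z r" for v
  proof -
    define u where "u = q - [:v:]"
    have du: "degree u = degree q"
      unfolding u_def using d by (metis degree_pCons_0 degree_add_eq_left degree_minus diff_conv_add_uminus)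
    have lu: "lead_coeff u = lead_coeff q"
      unfolding du unfolding u_def using d by (cases "degree q") auto
    obtain A where A: "size A = degree u" "u = smult (lead_coeff u) (\<Prod>w\<in>#A. [:-w,1:])"
    proof -
      obtain root where "smult (lead_coeff u) (\<Prod>i<degree u. [:-root i, 1:]) = u"
        using complex_poly_decompose' .
      then show ?thesis
        by (intro that[of "image_mset root (mset_set {..<degree u})"])
           (auto simp: prod_unfold_prod_mset multiset.map_comp o_def)
    qed
    have roots: "r \<le> norm (z - w)" if "w \<in># A" for w
    proof (rule ccontr)
      assume "\<not> r \<le> norm (z - w)"
      then have "w \<in> ball z r" by (simp add: dist_norm)
      moreover have "poly u w = 0"
        using that by (subst A(2)) (auto simp: poly_prod_mset dest!: multi_member_split)
      then have "poly q w = v" by (simp add: u_def)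
      ultimately show False using v by blast
    qed
    let ?Q = "\<Prod>w\<in>#A. [:-w,1:]"
    have 1: "dist (poly q z) v = norm (lead_coeff q) * norm (poly ?Q z)"
    proof -
      have "dist (poly q z) v = norm (poly u z)" by (simp add: u_def dist_norm)
      also have "\<dots> = norm (lead_coeff q) * norm (poly ?Q z)"
        by (subst A(2)) (simp add: lu norm_mult)
      finally show ?thesis .
    qed
    have "pderiv q = pderiv u" by (simp add: u_def pderiv_diff pderiv_pCons)
    then have 2: "norm (poly (pderiv q) z) = norm (lead_coeff q) * norm (poly (pderiv ?Q) z)"
      by (subst (asm) A(2)) (simp add: lu norm_mult pderiv_smult)
    have 3: "norm (lead_coeff q) * r ^ degree q \<le> norm (lead_coeff q) * norm (poly ?Q z)"
      using prod_mset_linear_factors_bounds(1)[of A r z, OF roots r] A(1) du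
      by (intro mult_left_mono) auto
    have "norm (lead_coeff q) * (norm (poly (pderiv ?Q) z) * r)
       \<le> norm (lead_coeff q) * (degree q * norm (poly ?Q z))"
      using prod_mset_linear_factors_bounds(2)[of A r z, OF roots r] A(1) du
      by (intro mult_left_mono) auto
    then have "norm (poly (pderiv q) z) * r / degree q \<le> norm (lead_coeff q) * norm (poly ?Q z)"
      using d unfolding 2 by (simp add: divide_simps mult_ac)
    with 1 3 show ?thesis by simp
  qed
  show "ball (poly q z) (norm (lead_coeff q) * r ^ degree q) \<subseteq> poly q ` ball z r"
    using key by fastforce
  show "ball (poly q z) (norm (poly (pderiv q) z) * r / degree q) \<subseteq> poly q ` ball z r"
    using key by fastforce
qed

lemma poly_lipschitz_on_cball:
  fixes q :: "complex poly"
  shows "\<exists>M>0. \<forall>x\<in>cball u B. \<forall>y\<in>cball u B. dist (poly q x) (poly q y) \<le> M * dist x y"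
proof -
  have "compact (poly (pderiv q) ` cball u B)"
    by (intro compact_continuous_image continuous_intros) auto
  then have "bounded (poly (pderiv q) ` cball u B)" by (rule compact_imp_bounded)
  then obtain M where M: "\<And>x. x \<in> cball u B \<Longrightarrow> norm (poly (pderiv q) x) \<le> M" "M > 0"
    unfolding bounded_pos by blast
  have "dist (poly q x) (poly q y) \<le> M * dist x y" if "x \<in> cball u B" "y \<in> cball u B" for x y
    unfolding dist_norm
    by (rule field_differentiable_bound[of "cball u B" "poly q" "poly (pderiv q)"])
       (use M that in \<open>auto intro: has_field_derivative_at_within poly_DERIV\<close>)
  with M(2) show ?thesis by blast
qed

section \<open>Recurrence of orbits to critical points\<close>

text \<open>The derivative is Lipschitz and vanishes at \<open>c\<close>, so on
  \<open>cball u s\<close> it is at most \<open>M * (dist u c + s)\<close>. The center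
  \<open>u\<close> is kept general because the bound is applied to balls that move along an
  orbit.\<close>

lemma poly_lipschitz_near_critical_point:
  fixes q :: "complex poly"
  assumes c: "poly (pderiv q) c = 0" "norm c \<le> B"
  shows "\<exists>M>0. \<forall>u s. norm u \<le> B \<longrightarrow> s \<le> 1 \<longrightarrow>
     (\<forall>x\<in>cball u s. \<forall>y\<in>cball u s. dist (poly q x) (poly q y) \<le> M * (dist u c + s) * dist x y)"
proof -
  obtain M where M: "M > 0"
    "\<And>x y. x \<in> cball 0 (B+1) \<Longrightarrow> y \<in> cball 0 (B+1) \<Longrightarrow>
        dist (poly (pderiv q) x) (poly (pderiv q) y) \<le> M * dist x y"
    using poly_lipschitz_on_cball[of 0 "B+1" "pderiv q"] by blast
  have "dist (poly q x) (poly q y) \<le> M * (dist u c + s) * dist x y"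
    if u: "norm u \<le> B" "s \<le> 1" and xy: "x \<in> cball u s" "y \<in> cball u s" for u s x y
    unfolding dist_norm[of "poly q x"] dist_norm[of x]
  proof (rule field_differentiable_bound[of "cball u s" "poly q" "poly (pderiv q)"])
    fix w assume w: "w \<in> cball u s"
    have "norm w \<le> B + 1"
      using w u norm_triangle_ineq2[of w u] by (auto simp: dist_norm norm_minus_commute)
    then have "dist (poly (pderiv q) w) (poly (pderiv q) c) \<le> M * dist w c"
      using c by (intro M(2)) auto
    also have "\<dots> \<le> M * (dist u c + s)"
      using w M(1) dist_triangle[of w c u] by (intro mult_left_mono) (auto simp: dist_commute)
    finally show "norm (poly (pderiv q) w) \<le> M * (dist u c + s)"
      using c by (simp add: dist_norm)
  qed (use xy in \<open>auto intro: has_field_derivative_at_within poly_DERIV\<close>)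
  with M(1) show ?thesis by blast
qed

text \<open>If the product of distances along a return to the \<open>r\<close>-neighbourhood of \<open>c\<close> were too small,
  the return map would contract \<open>cball c (2 * r)\<close> into itself.\<close>

lemma contraction_at_first_return:
  fixes p :: "complex \<Rightarrow> complex"
  assumes lip: "\<And>u s x x'. norm u \<le> B \<Longrightarrow> s \<le> 1 \<Longrightarrow> x \<in> cball u s \<Longrightarrow> x' \<in> cball u s \<Longrightarrow>
        dist (p x) (p x') \<le> M * (dist u c + s) * dist x x'"
    and M: "M > 0" and th: "2 * M * th \<le> 1/4" "th > 0" and c: "norm c \<le> B"
    and ij: "i < j"
    and orb: "\<And>l. i \<le> l \<Longrightarrow> l < j \<Longrightarrow> y (Suc l) = p (y l)"
    and bd: "\<And>l. i \<le> l \<Longrightarrow> l \<le> j \<Longrightarrow> norm (y l) \<le> B"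
    and r: "0 < r" "r \<le> 1/2" "dist (y i) c \<le> r" "dist (y j) c \<le> r"
    and far: "\<And>q. i < q \<Longrightarrow> q < j \<Longrightarrow> r < dist (y q) c"
    and small: "\<And>l. i < l \<Longrightarrow> l \<le> j \<Longrightarrow> r * (\<Prod>q\<in>{Suc i..<l}. dist (y q) c) < th ^ (l - i)"
  shows "\<exists>k>0. \<exists>w. dist w c \<le> 2 * r \<and> (\<lambda>n. (p ^^ (k * n)) c) \<longlonglongrightarrow> w"
proof -
  \<comment> \<open>\<open>L l\<close> will bound the Lipschitz constant of the iterate from time
    \<open>i\<close> to time \<open>l\<close> on \<open>cball c (2 * r)\<close>. The first step, at
    the ball around \<open>c\<close> itself, contributes \<open>M * (2 * r)\<close>; each later one
    contributes \<open>M * (dist (y q) c + r)\<close>, at most \<open>2 * M * dist (y q) c\<close>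
    by \<open>far\<close>.\<close>
  define L where "L l = (2*M)^(l-i) * (r * (\<Prod>q\<in>{Suc i..<l}. dist (y q) c))" for l
  have L0: "L l \<ge> 0" for l unfolding L_def using M r by (auto intro!: mult_nonneg_nonneg prod_nonneg)
  have L4: "L l \<le> 1/4" if "i < l" "l \<le> j" for l
  proof -
    have "L l \<le> (2*M)^(l-i) * th ^ (l-i)" unfolding L_def
      using small[OF that] M by (intro mult_left_mono) auto
    also have "\<dots> = (2*M*th)^(l-i)" by (simp add: power_mult_distrib)
    also have "\<dots> \<le> (1/4)^(l-i)" using th M by (intro power_mono) auto
    also have "\<dots> \<le> (1/4)^1" using that by (intro power_decreasing) auto
    finally show ?thesis by simp
  qed
  have yit: "(p ^^ n) (y i) = y (i + n)" if "i + n \<le> j" for n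
    using that by (induction n) (auto simp: orb)
  have claim: "dist ((p ^^ n) x) ((p ^^ n) x') \<le> L (i + n) * dist x x'"
    if "0 < n" "i + n \<le> j" "x \<in> cball c (2*r)" "x' \<in> cball c (2*r)" for n x x'
    using that
  proof (induction n arbitrary: x x')
    case 0 then show ?case by simp
  next
    case (Suc n)
    show ?case
    proof (cases "n = 0")
      case True
      have "dist (p x) (p x') \<le> M * (dist c c + 2*r) * dist x x'"
        using Suc.prems r c by (intro lip) auto
      with True show ?thesis by (simp add: L_def mult_ac)
    next
      case False
      then have n: "0 < n" "i + n < j" using Suc.prems by auto
      \<comment> \<open>Points of \<open>cball c (2 * r)\<close> are within \<open>3 * r\<close> of
        \<open>y i\<close>, and the constant so far is at most \<open>1/4\<close>; so their images
        stay within \<open>r\<close> of the orbit and the local Lipschitz bound applies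
        again.\<close>
      have near: "(p ^^ n) w \<in> cball (y (i+n)) r" if w: "w \<in> cball c (2*r)" for w
      proof -
        have "dist (y (i+n)) ((p^^n) w) = dist ((p^^n) (y i)) ((p^^n) w)"
          using n by (simp add: yit)
        also have "\<dots> \<le> L (i+n) * dist (y i) w"
          using Suc.IH[of "y i" w] n w r by (auto simp: dist_commute)
        also have "\<dots> \<le> 1/4 * (3 * r)"
          using L4[of "i+n"] n w r L0 dist_triangle[of "y i" w c]
          by (intro mult_mono) (auto simp: dist_commute)
        finally show ?thesis using r by auto
      qed
      have "dist (p ((p^^n) x)) (p ((p^^n) x'))
          \<le> M * (dist (y (i+n)) c + r) * dist ((p^^n) x) ((p^^n) x')"
        using near Suc.prems bd n r by (intro lip) auto
      also have "\<dots> \<le> M * (dist (y (i+n)) c + dist (y (i+n)) c) * (L (i+n) * dist x x')"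
        using Suc.IH[of x x'] Suc.prems n far[of "i+n"] M r
        by (intro mult_mono mult_left_mono) auto
      also have "\<dots> = L (i + Suc n) * dist x x'"
        using n by (simp add: L_def prod.op_ivl_Suc Suc_diff_le mult_ac)
      finally show ?thesis by simp
    qed
  qed
  define k where "k = j - i"
  have k: "0 < k" "i + k = j" using ij by (auto simp: k_def)
  have contr: "dist ((p ^^ k) x) ((p ^^ k) x') \<le> 1/4 * dist x x'"
    if "x \<in> cball c (2*r)" "x' \<in> cball c (2*r)" for x x'
  proof -
    have "dist ((p ^^ k) x) ((p ^^ k) x') \<le> L j * dist x x'" using claim[of k x x'] k that by simp
    also have "\<dots> \<le> 1/4 * dist x x'" using L4[of j] ij by (intro mult_right_mono) auto
    finally show ?thesis .
  qed
  have yi: "y i \<in> cball c (2*r)" using r by (simp add: dist_commute)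
  have maps: "(p ^^ k) x \<in> cball c (2*r)" if "x \<in> cball c (2*r)" for x
  proof -
    have "dist (y j) ((p^^k) x) \<le> 1/4 * dist (y i) x"
      using contr[OF yi that] yit[of k] k by simp
    also have "dist (y i) x \<le> 3 * r" using that r dist_triangle[of "y i" x c] by auto
    finally show ?thesis using r dist_triangle[of c "(p^^k) x" "y j"] by (auto simp: dist_commute)
  qed
  have "\<exists>!w\<in>cball c (2*r). (p ^^ k) w = w"
    by (rule Banach_fix[of _ "1/4"]) (use contr maps r in \<open>auto simp: complete_eq_closed\<close>)
  then obtain w where w: "w \<in> cball c (2*r)" "(p ^^ k) w = w" by blast
  have cc: "c \<in> cball c (2*r)" using r by simp
  have it: "(p ^^ (k * n)) c \<in> cball c (2*r) \<and> dist ((p ^^ (k * n)) c) w \<le> (1/4)^n * dist c w" for n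
  proof (induction n)
    case 0 then show ?case using cc by simp
  next
    case (Suc n)
    have e: "(p ^^ (k * Suc n)) c = (p ^^ k) ((p ^^ (k*n)) c)"
      by (simp add: funpow_add)
    have "dist ((p ^^ (k * Suc n)) c) w \<le> 1/4 * dist ((p ^^ (k*n)) c) w"
      unfolding e using contr[of "(p ^^ (k*n)) c" w] Suc w by simp
    with Suc maps show ?case unfolding e by auto
  qed
  have "(\<lambda>n. (1/4)^n * dist c w) \<longlonglongrightarrow> 0"
    by (intro tendsto_mult_left_zero LIMSEQ_power_zero) auto
  then have "(\<lambda>n. (p ^^ (k * n)) c) \<longlonglongrightarrow> w"
    by (rule metric_tendsto_imp_tendsto) (use it in \<open>simp add: eventually_sequentially\<close>)
  moreover have "dist w c \<le> 2 * r" using w by (simp add: dist_commute)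
  ultimately show ?thesis using k(1) by blast
qed

lemma funpow_mult_tendsto_unique:
  fixes p :: "complex \<Rightarrow> complex"
  assumes "(\<lambda>n. (p ^^ (k * n)) c) \<longlonglongrightarrow> w" "(\<lambda>n. (p ^^ (k' * n)) c) \<longlonglongrightarrow> w'" "k > 0" "k' > 0"
  shows "w = w'"
proof (rule LIMSEQ_unique)
  have "strict_mono (\<lambda>n. k' * n)" "strict_mono (\<lambda>n. k * n)"
    using assms by (auto simp: strict_mono_def)
  from LIMSEQ_subseq_LIMSEQ[OF assms(1) this(1)] LIMSEQ_subseq_LIMSEQ[OF assms(2) this(2)]
  show "(\<lambda>n. (p ^^ (k * (k' * n))) c) \<longlonglongrightarrow> w" "(\<lambda>n. (p ^^ (k * (k' * n))) c) \<longlonglongrightarrow> w'"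
    by (auto simp: o_def mult_ac)
qed

text \<open>Violations at arbitrarily small scales \<open>r\<close> would force \<open>c\<close> to be periodic, because the
  attracting points found at different scales are all limits of the same critical orbit.\<close>

lemma critical_return_bound:
  fixes q :: "complex poly"
  assumes crit: "poly (pderiv q) c = 0" and nonper: "\<And>k. k > 0 \<Longrightarrow> (poly q ^^ k) c \<noteq> c"
  shows "\<exists>th>0. th \<le> 1 \<and> (\<forall>y i j r. i < j \<longrightarrow> (\<forall>l. i \<le> l \<and> l < j \<longrightarrow> y (Suc l) = poly q (y l)) \<longrightarrow>
     (\<forall>l. i \<le> l \<and> l \<le> j \<longrightarrow> norm (y l) \<le> B) \<longrightarrow> 0 \<le> r \<longrightarrow> dist (y i) c \<le> r \<longrightarrow> dist (y j) c \<le> r \<longrightarrow>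
     (\<exists>l. i < l \<and> l \<le> j \<and> th ^ (l - i) \<le> r * (\<Prod>m\<in>{Suc i..<l}. dist (y m) c)))"
proof -
  define B' where "B' = max B (norm c)"
  have "norm c \<le> B'" by (simp add: B'_def)
  with poly_lipschitz_near_critical_point[OF crit this] obtain M where M: "M > 0"
    "\<And>u s x x'. norm u \<le> B' \<Longrightarrow> s \<le> 1 \<Longrightarrow> x \<in> cball u s \<Longrightarrow> x' \<in> cball u s \<Longrightarrow>
        dist (poly q x) (poly q x') \<le> M * (dist u c + s) * dist x x'" by blast
  define t0 where "t0 = 1 / (8 * M)"
  define orbit where "orbit y i j \<longleftrightarrow> i < j \<and> (\<forall>l. i \<le> l \<and> l < j \<longrightarrow> y (Suc l) = poly q (y l)) \<and>
     (\<forall>l. i \<le> l \<and> l \<le> j \<longrightarrow> norm (y l) \<le> B)" for y :: "nat \<Rightarrow> complex" and i j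
  define bad where "bad r \<longleftrightarrow> (\<exists>y i j. orbit y i j \<and> dist (y i) c \<le> r \<and> dist (y j) c \<le> r \<and>
     (\<forall>l. i < l \<and> l \<le> j \<longrightarrow> r * (\<Prod>m\<in>{Suc i..<l}. dist (y m) c) < t0 ^ (l - i)))" for r
  have bad_lim: "\<exists>k>0. \<exists>w. dist w c \<le> 2 * r \<and> (\<lambda>n. (poly q ^^ (k * n)) c) \<longlonglongrightarrow> w"
    if r: "bad r" "0 < r" "r \<le> 1/2" for r
  proof -
    obtain y i j where y: "orbit y i j" "dist (y i) c \<le> r" "dist (y j) c \<le> r"
      "\<And>l. i < l \<Longrightarrow> l \<le> j \<Longrightarrow> r * (\<Prod>m\<in>{Suc i..<l}. dist (y m) c) < t0 ^ (l - i)"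
      using r(1) unfolding bad_def by blast
    \<comment> \<open>Only the first return satisfies the hypothesis \<open>far\<close> of the
      contraction lemma; the smallness of the products up to \<open>j\<close> covers those up to
      \<open>j'\<close>.\<close>
    define j' where "j' = (LEAST l. i < l \<and> dist (y l) c \<le> r)"
    have j': "i < j' \<and> dist (y j') c \<le> r" "j' \<le> j"
      unfolding j'_def using y by (auto simp: orbit_def intro: LeastI2_ex Least_le)
    have far: "r < dist (y l) c" if "i < l" "l < j'" for l
      using not_less_Least[of l "\<lambda>l. i < l \<and> dist (y l) c \<le> r"] that by (auto simp: j'_def)
    show ?thesis
    proof (rule contraction_at_first_return[where y = y and i = i and j = j' and B = B' and th = t0 and M = M])
      show "norm (y l) \<le> B'" if "i \<le> l" "l \<le> j'" for l
        using that j' y(1) unfolding orbit_def B'_def by force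
      show "2 * M * t0 \<le> 1/4" "0 < t0" using M(1) by (auto simp: t0_def)
      show "y (Suc l) = poly q (y l)" if "i \<le> l" "l < j'" for l
        using that j' y(1) unfolding orbit_def by force
      show "r * (\<Prod>m\<in>{Suc i..<l}. dist (y m) c) < t0 ^ (l - i)" if "i < l" "l \<le> j'" for l
        using that j' by (intro y(4)) auto
      show "norm c \<le> B'" by (simp add: B'_def)
      show "dist (y j') c \<le> r" "i < j'" using j' by auto
    qed (fact M far r y)+
  qed
  have "\<exists>r0>0. r0 \<le> 1/2 \<and> (\<forall>r. 0 < r \<and> r < r0 \<longrightarrow> \<not> bad r)"
  proof (rule ccontr)
    assume "\<not> ?thesis"
    then have badex: "\<exists>r. 0 < r \<and> r < r0 \<and> bad r" if "0 < r0" "r0 \<le> 1/2" for r0 using that by blast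
    obtain r1 where "0 < r1" "r1 < 1/2" "bad r1" using badex[of "1/2"] by auto
    then have "\<exists>k>0. \<exists>w. dist w c \<le> 2 * r1 \<and> (\<lambda>n. (poly q ^^ (k * n)) c) \<longlonglongrightarrow> w"
      by (intro bad_lim) auto
    then obtain k w where kw: "k > 0" "(\<lambda>n. (poly q ^^ (k * n)) c) \<longlonglongrightarrow> w" by blast
    have "dist w c \<le> 2 * e" if e: "0 < e" "e \<le> 1/2" for e
    proof -
      obtain r where r: "0 < r" "r < e" "bad r" using badex[OF e] by blast
      then have "\<exists>k>0. \<exists>w. dist w c \<le> 2 * r \<and> (\<lambda>n. (poly q ^^ (k * n)) c) \<longlonglongrightarrow> w"
        using e by (intro bad_lim) auto
      then obtain k' w' where k': "k' > 0" "dist w' c \<le> 2 * r" "(\<lambda>n. (poly q ^^ (k' * n)) c) \<longlonglongrightarrow> w'"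
        by blast
      have "w' = w" using funpow_mult_tendsto_unique[OF k'(3) kw(2) k'(1) kw(1)] .
      with k' r show ?thesis by simp
    qed
    note close = this
    have wc: "w = c"
    proof (rule ccontr)
      assume "w \<noteq> c"
      then have "0 < dist w c" by simp
      then have "dist w c \<le> 2 * min (1/2) (dist w c / 3)" by (intro close) auto
      with \<open>0 < dist w c\<close> show False by linarith
    qed
    have cont: "isCont (poly q ^^ k) c"
    proof -
      have "continuous_on UNIV (poly q ^^ k)"
        by (induction k) (auto intro!: continuous_intros)
      then show ?thesis by (simp add: continuous_on_eq_continuous_at)
    qed
    \<comment> \<open>The orbit of \<open>c\<close> along multiples of \<open>k\<close> tends to
      \<open>c\<close>; by continuity \<open>c\<close> is fixed by the \<open>k\<close>-th iterate,
      against \<open>nonper\<close>.\<close>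
    have "(\<lambda>n. (poly q ^^ k) ((poly q ^^ (k * n)) c)) \<longlonglongrightarrow> (poly q ^^ k) c"
      using isCont_tendsto_compose[OF cont] kw(2) wc by simp
    moreover have "(\<lambda>n. (poly q ^^ (k * Suc n)) c) \<longlonglongrightarrow> c"
      using LIMSEQ_Suc[OF kw(2)] wc by simp
    ultimately have "(poly q ^^ k) c = c"
      by (intro LIMSEQ_unique[of "\<lambda>n. (poly q ^^ (k * Suc n)) c"]) (auto simp: funpow_add)
    with nonper kw show False by blast
  qed
  then obtain r0 where r0: "r0 > 0" "r0 \<le> 1/2" "\<And>r. 0 < r \<Longrightarrow> r < r0 \<Longrightarrow> \<not> bad r" by blast
  \<comment> \<open>\<open>t0\<close> serves the scales below \<open>r0\<close>. At larger scales
    one step suffices: for \<open>l = Suc i\<close> the product is empty, and th \<le> r0 \<le>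
    r.\<close>
  define th where "th = min t0 r0"
  have th: "0 < th" "th \<le> 1" "th \<le> t0" "th \<le> r0" using M r0 by (auto simp: th_def t0_def)
  have main: "\<exists>l. i < l \<and> l \<le> j \<and> th ^ (l - i) \<le> r * (\<Prod>m\<in>{Suc i..<l}. dist (y m) c)"
    if ij: "i < j" and orb: "\<forall>l. i \<le> l \<and> l < j \<longrightarrow> y (Suc l) = poly q (y l)"
      and bd: "\<forall>l. i \<le> l \<and> l \<le> j \<longrightarrow> norm (y l) \<le> B"
      and r: "0 \<le> r" "dist (y i) c \<le> r" "dist (y j) c \<le> r" for y i j r
  proof (cases "r < r0")
    case False
    then show ?thesis using th ij by (intro exI[of _ "Suc i"]) auto
  next
    case True
    have "r \<noteq> 0"
    proof
      assume "r = 0"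
      then have "y i = c" "y j = c" using r by auto
      moreover have "(poly q ^^ n) (y i) = y (i + n)" if "i + n \<le> j" for n
        using that by (induction n) (auto simp: orb)
      from this[of "j - i"] have "(poly q ^^ (j-i)) (y i) = y j" using ij by simp
      ultimately show False using nonper[of "j-i"] ij by simp
    qed
    with r have "0 < r" by simp
    with r0 True have nb: "\<not> bad r" by blast
    have "\<exists>l. i < l \<and> l \<le> j \<and> \<not> r * (\<Prod>m\<in>{Suc i..<l}. dist (y m) c) < t0 ^ (l - i)"
    proof (rule ccontr)
      assume "\<not> ?thesis"
      then have "\<forall>l. i < l \<and> l \<le> j \<longrightarrow> r * (\<Prod>m\<in>{Suc i..<l}. dist (y m) c) < t0 ^ (l - i)" by blast
      moreover have "orbit y i j" unfolding orbit_def using ij orb bd by (intro conjI)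
      ultimately have "bad r" unfolding bad_def using r(2,3) by (intro exI conjI)
      with nb show False ..
    qed
    then obtain l where l: "i < l" "l \<le> j" "t0 ^ (l - i) \<le> r * (\<Prod>m\<in>{Suc i..<l}. dist (y m) c)"
      unfolding not_less by blast
    have "th ^ (l-i) \<le> t0 ^ (l-i)" using th by (intro power_mono) auto
    then show ?thesis using l by (intro exI[of _ l] conjI order_trans[OF _ l(3)])
  qed
  show ?thesis using th(1,2) by (intro exI[of _ th] conjI allI impI) (assumption | (rule main; assumption))+
qed

text \<open>The removed factor is the smallest one. Before it and after it, the step hypothesis is applied
  between successive minima.\<close>

lemma prod_except_min_bound:
  fixes \<rho> :: "nat \<Rightarrow> real"
  assumes th: "0 < th" "th \<le> 1" and n: "0 < n" and nn: "\<And>l. 0 \<le> \<rho> l"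
    and step: "\<And>i j r. i < j \<Longrightarrow> j < n \<Longrightarrow> 0 \<le> r \<Longrightarrow> \<rho> i \<le> r \<Longrightarrow> \<rho> j \<le> r \<Longrightarrow>
      \<exists>l. i < l \<and> l \<le> j \<and> th ^ (l - i) \<le> r * (\<Prod>m\<in>{Suc i..<l}. \<rho> m)"
  shows "\<exists>m<n. th ^ n \<le> (\<Prod>l\<in>{..<n} - {m}. \<rho> l)"
proof -
  \<comment> \<open>The value at \<open>j\<close> is the smaller one, so \<open>step\<close> applies
    with \<open>r = \<rho> i\<close>; this \<open>r\<close> supplies the missing factor at index
    \<open>i\<close>.\<close>
  have before: "th ^ (j - i) \<le> prod \<rho> {i..<j}"
    if "i \<le> j" "j < n" "\<And>q. i \<le> q \<Longrightarrow> q < j \<Longrightarrow> \<rho> j \<le> \<rho> q" for i j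
    using that
  proof (induction "j - i" arbitrary: i rule: less_induct)
    case less
    show ?case
    proof (cases "i = j")
      case False
      with less have ij: "i < j" by simp
      obtain l where l: "i < l" "l \<le> j" "th ^ (l - i) \<le> \<rho> i * (\<Prod>m\<in>{Suc i..<l}. \<rho> m)"
        using step[OF ij less.prems(2) nn[of i]] less.prems(3)[of i] ij by auto
      then have 1: "th ^ (l - i) \<le> prod \<rho> {i..<l}" by (simp add: prod.atLeast_Suc_lessThan)
      have 2: "th ^ (j - l) \<le> prod \<rho> {l..<j}"
        using l less.prems by (intro less.hyps) auto
      have "th ^ (j - i) = th ^ (l - i) * th ^ (j - l)"
        using l by (simp flip: power_add)
      also have "\<dots> \<le> prod \<rho> {i..<l} * prod \<rho> {l..<j}"
        using 1 2 th nn by (intro mult_mono prod_nonneg) auto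
      also have "\<dots> = prod \<rho> {i..<j}" using l by (simp add: prod.atLeastLessThan_concat)
      finally show ?thesis .
    qed simp
  qed
  \<comment> \<open>Now the right end has the larger value, so \<open>r = \<rho> j\<close> and the
    factor supplied is the one at index \<open>j\<close>. The rest, from \<open>l\<close> to
    \<open>j\<close>, is covered by \<open>before\<close>.\<close>
  have between: "th ^ (j - i) \<le> prod \<rho> {Suc i..<Suc j}"
    if ij: "i < j" "j < n" "\<rho> i \<le> \<rho> j" "\<And>q. i < q \<Longrightarrow> q < j \<Longrightarrow> \<rho> j \<le> \<rho> q" for i j
  proof -
    obtain l where l: "i < l" "l \<le> j" "th ^ (l - i) \<le> \<rho> j * (\<Prod>m\<in>{Suc i..<l}. \<rho> m)"
      using step[OF ij(1,2) nn[of j] ij(3)] by auto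
    have 2: "th ^ (j - l) \<le> prod \<rho> {l..<j}" using l ij by (intro before) auto
    have "th ^ (j - i) = th ^ (l - i) * th ^ (j - l)"
      using l by (simp flip: power_add)
    also have "\<dots> \<le> (\<rho> j * prod \<rho> {Suc i..<l}) * prod \<rho> {l..<j}"
      using l(3) 2 th nn by (intro mult_mono prod_nonneg mult_nonneg_nonneg) auto
    also have "\<dots> = \<rho> j * prod \<rho> {Suc i..<j}"
      using l by (simp add: prod.atLeastLessThan_concat mult.assoc)
    also have "\<dots> = prod \<rho> {Suc i..<Suc j}" using ij by (simp add: mult.commute)
    finally show ?thesis .
  qed
  have after: "th ^ (n - Suc i) \<le> prod \<rho> {Suc i..<n}"
    if "i < n" "\<And>q. i < q \<Longrightarrow> q < n \<Longrightarrow> \<rho> i \<le> \<rho> q" for i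
    using that
  proof (induction "n - i" arbitrary: i rule: less_induct)
    case less
    show ?case
    proof (cases "Suc i < n")
      case True
      define j where "j = arg_min_on \<rho> {i<..<n}"
      have ne: "finite {i<..<n}" "{i<..<n} \<noteq> {}" using True by auto
      have j: "i < j" "j < n" "\<And>q. i < q \<Longrightarrow> q < n \<Longrightarrow> \<rho> j \<le> \<rho> q"
        using arg_min_if_finite(1)[OF ne, of \<rho>] arg_min_least[OF ne, of _ \<rho>] by (auto simp: j_def)
      have 1: "th ^ (j - i) \<le> prod \<rho> {Suc i..<Suc j}"
        using j less.prems by (intro between) auto
      have 2: "th ^ (n - Suc j) \<le> prod \<rho> {Suc j..<n}"
        using j less.prems by (intro less.hyps) auto
      have "th ^ (n - Suc i) = th ^ (j - i) * th ^ (n - Suc j)"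
        using j by (simp flip: power_add)
      also have "\<dots> \<le> prod \<rho> {Suc i..<Suc j} * prod \<rho> {Suc j..<n}"
        using 1 2 th nn by (intro mult_mono prod_nonneg) auto
      also have "\<dots> = prod \<rho> {Suc i..<n}"
        using j by (intro prod.atLeastLessThan_concat) auto
      finally show ?thesis .
    qed (use less in auto)
  qed
  define m where "m = arg_min_on \<rho> {..<n}"
  have ne: "finite {..<n}" "{..<n} \<noteq> {}" using n by auto
  have m: "m < n" "\<And>q. q < n \<Longrightarrow> \<rho> m \<le> \<rho> q"
    using arg_min_if_finite(1)[OF ne, of \<rho>] arg_min_least[OF ne, of _ \<rho>] by (auto simp: m_def)
  have "th ^ n \<le> th ^ (m + (n - Suc m))" using th m by (intro power_decreasing) auto
  also have "\<dots> = th ^ (m - 0) * th ^ (n - Suc m)" by (simp add: power_add)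
  also have "\<dots> \<le> prod \<rho> {0..<m} * prod \<rho> {Suc m..<n}"
    using before[of 0 m] after[of m] m th nn by (intro mult_mono prod_nonneg) auto
  also have "\<dots> = prod \<rho> ({0..<m} \<union> {Suc m..<n})" by (subst prod.union_disjoint) auto
  also have "{0..<m} \<union> {Suc m..<n} = {..<n} - {m}" using m by auto
  finally show ?thesis using m by blast
qed

section \<open>Distances to critical points and derivatives along orbits of one polynomial\<close>

text \<open>The periodic critical points are the superattracting ones, exactly those to which the
  return bound does not apply.\<close>

definition avoids_periodic_critical :: "complex poly \<Rightarrow> real \<Rightarrow> complex \<Rightarrow> bool" where
  "avoids_periodic_critical q \<epsilon> z \<longleftrightarrow>
     (\<forall>c k. poly (pderiv q) c = 0 \<longrightarrow> k > 0 \<longrightarrow> (poly q ^^ k) c = c \<longrightarrow> \<epsilon> \<le> dist z c)"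

text \<open>For periodic \<open>c\<close> the distance \<epsilon> suffices at all times; otherwise
  the return bound yields the product bound with its smallest factor removed. Logarithms turn it
  into nonnegative losses \<open>b\<close>, the form in which the contributions of several critical
  points add up.\<close>

lemma orbit_distance_to_critical_point:
  fixes q :: "complex poly"
  assumes crit: "poly (pderiv q) c = 0" and eps: "\<epsilon> > 0"
  shows "\<exists>Th\<ge>0. \<forall>n y. 0 < n \<longrightarrow> (\<forall>l. Suc l < n \<longrightarrow> y (Suc l) = poly q (y l)) \<longrightarrow>
     (\<forall>l<n. norm (y l) \<le> B) \<longrightarrow> (\<forall>l<n. avoids_periodic_critical q \<epsilon> (y l)) \<longrightarrow>
     (\<exists>m<n. \<exists>b. (\<forall>l\<in>{..<n}-{m}. 0 \<le> b l \<and> exp (- b l) \<le> dist (y l) c) \<and> sum b ({..<n}-{m}) \<le> Th * real n)"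
proof -
  have "\<exists>th>0. th \<le> 1 \<and> (\<forall>n y. 0 < n \<longrightarrow> (\<forall>l. Suc l < n \<longrightarrow> y (Suc l) = poly q (y l)) \<longrightarrow>
     (\<forall>l<n. norm (y l) \<le> B) \<longrightarrow> (\<forall>l<n. avoids_periodic_critical q \<epsilon> (y l)) \<longrightarrow>
     (\<exists>m<n. th ^ n \<le> (\<Prod>l\<in>{..<n}-{m}. dist (y l) c)))"
  proof (cases "\<exists>k>0. (poly q ^^ k) c = c")
    case True
    define th where "th = min 1 \<epsilon>"
    have th: "0 < th" "th \<le> 1" using eps by (auto simp: th_def)
    have "th ^ n \<le> (\<Prod>l\<in>{..<n}-{0}. dist (y l) c)"
      if "0 < n" and a: "\<forall>l<n. avoids_periodic_critical q \<epsilon> (y l)" for n and y :: "nat \<Rightarrow> complex"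
    proof -
      have "th ^ n \<le> th ^ (n - 1)" using th by (intro power_decreasing) auto
      also have "\<dots> = (\<Prod>l\<in>{..<n}-{0}. th)" using that by (simp add: card_Diff_singleton)
      also have "\<dots> \<le> (\<Prod>l\<in>{..<n}-{0}. dist (y l) c)"
      proof (rule prod_mono)
        fix l assume "l \<in> {..<n}-{0}"
        then have "\<epsilon> \<le> dist (y l) c"
          using a True crit unfolding avoids_periodic_critical_def by blast
        then show "0 \<le> th \<and> th \<le> dist (y l) c" using th by (auto simp: th_def)
      qed
      finally show ?thesis .
    qed
    with th show ?thesis by (intro exI[of _ th] conjI allI impI exI[of _ 0]) simp_all
  next
    case False
    then have np: "\<And>k. k > 0 \<Longrightarrow> (poly q ^^ k) c \<noteq> c" by blast
    obtain th where th: "0 < th" "th \<le> 1" and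
      ret: "\<forall>y i j r. i < j \<longrightarrow> (\<forall>l. i \<le> l \<and> l < j \<longrightarrow> y (Suc l) = poly q (y l)) \<longrightarrow>
        (\<forall>l. i \<le> l \<and> l \<le> j \<longrightarrow> norm (y l) \<le> B) \<longrightarrow> 0 \<le> r \<longrightarrow> dist (y i) c \<le> r \<longrightarrow> dist (y j) c \<le> r \<longrightarrow>
        (\<exists>l. i < l \<and> l \<le> j \<and> th ^ (l - i) \<le> r * (\<Prod>m\<in>{Suc i..<l}. dist (y m) c))"
      using critical_return_bound[OF crit np, of B] by blast
    have "\<exists>m<n. th ^ n \<le> (\<Prod>l\<in>{..<n}-{m}. dist (y l) c)"
      if yn: "0 < n" "\<forall>l. Suc l < n \<longrightarrow> y (Suc l) = poly q (y l)" "\<forall>l<n. norm (y l) \<le> B"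
      for n and y :: "nat \<Rightarrow> complex"
    proof -
      have step: "\<exists>l. i < l \<and> l \<le> j \<and> th ^ (l - i) \<le> r * (\<Prod>m\<in>{Suc i..<l}. dist (y m) c)"
        if ij: "i < j" "j < n" and r: "0 \<le> r" "dist (y i) c \<le> r" "dist (y j) c \<le> r" for i j r
      proof -
        have "\<forall>l. i \<le> l \<and> l < j \<longrightarrow> y (Suc l) = poly q (y l)" "\<forall>l. i \<le> l \<and> l \<le> j \<longrightarrow> norm (y l) \<le> B"
          using yn(2,3) ij by auto
        with ij r show ?thesis using ret by blast
      qed
      show ?thesis
        by (rule prod_except_min_bound[of th n "\<lambda>l. dist (y l) c"]) (fact th yn(1) zero_le_dist | erule (4) step)+
    qed
    with th show ?thesis by (intro exI[of _ th] conjI allI impI) simp_all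
  qed
  then obtain th where th: "0 < th" "th \<le> 1" and
    prd: "\<forall>n y. 0 < n \<longrightarrow> (\<forall>l. Suc l < n \<longrightarrow> y (Suc l) = poly q (y l)) \<longrightarrow>
     (\<forall>l<n. norm (y l) \<le> B) \<longrightarrow> (\<forall>l<n. avoids_periodic_critical q \<epsilon> (y l)) \<longrightarrow>
     (\<exists>m<n. th ^ n \<le> (\<Prod>l\<in>{..<n}-{m}. dist (y l) c))" by (elim exE conjE)
  \<comment> \<open>\<open>B2\<close> bounds the distances to \<open>c\<close>, which makes the
    losses \<open>ln (B2 / dist (y l) c)\<close> nonnegative; \<open>1 \<le> B2\<close> keeps
    \<open>exp (- b l)\<close> below the distance itself.\<close>
  define B2 where "B2 = \<bar>B\<bar> + norm c + 1"
  have B2: "1 \<le> B2" by (simp add: B2_def)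
  define Th where "Th = ln B2 - ln th"
  have Th: "0 \<le> Th" using B2 th by (simp add: Th_def)
  have main: "\<exists>m<n. \<exists>b. (\<forall>l\<in>{..<n}-{m}. 0 \<le> b l \<and> exp (- b l) \<le> dist (y l) c) \<and> sum b ({..<n}-{m}) \<le> Th * real n"
    if n: "0 < n" and orb: "\<forall>l. Suc l < n \<longrightarrow> y (Suc l) = poly q (y l)"
      and bd: "\<forall>l<n. norm (y l) \<le> B" and av: "\<forall>l<n. avoids_periodic_critical q \<epsilon> (y l)" for n y
  proof -
    obtain m where m: "m < n" "th ^ n \<le> (\<Prod>l\<in>{..<n}-{m}. dist (y l) c)"
      using prd[THEN spec, THEN spec, THEN mp, THEN mp, THEN mp, THEN mp, OF n orb bd av] by (elim exE conjE)
    have "0 < th ^ n" using th by simp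
    with m have "(\<Prod>l\<in>{..<n}-{m}. dist (y l) c) \<noteq> 0" by linarith
    then have pos: "0 < dist (y l) c" if "l \<in> {..<n}-{m}" for l
      using that by (subst (asm) prod_zero_iff) auto
    define b where "b l = ln B2 - ln (dist (y l) c)" for l
    have b: "0 \<le> b l \<and> exp (- b l) \<le> dist (y l) c" if l: "l \<in> {..<n}-{m}" for l
    proof -
      have "dist (y l) c \<le> norm (y l) + norm c" by (simp add: dist_norm norm_triangle_ineq4)
      then have "dist (y l) c \<le> B2" using bd l by (force simp: B2_def)
      then have "ln (dist (y l) c) \<le> ln B2" using pos[OF l] B2 by (subst ln_le_cancel_iff) auto
      moreover have "exp (- b l) = dist (y l) c / B2"
        using pos[OF l] B2 by (simp add: b_def exp_diff)
      moreover have "dist (y l) c / B2 \<le> dist (y l) c / 1"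
        using B2 by (intro divide_left_mono) auto
      ultimately show ?thesis by (simp add: b_def)
    qed
    have "n * ln th = ln (th ^ n)" using th by (simp add: ln_realpow)
    also have "\<dots> \<le> ln (\<Prod>l\<in>{..<n}-{m}. dist (y l) c)"
      using m \<open>0 < th ^ n\<close> by (subst ln_le_cancel_iff) auto
    also have "\<dots> = (\<Sum>l\<in>{..<n}-{m}. ln (dist (y l) c))"
      using pos by (intro ln_prod) auto
    finally have 1: "n * ln th \<le> (\<Sum>l\<in>{..<n}-{m}. ln (dist (y l) c))" .
    have "(\<Sum>l\<in>{..<n}-{m}. ln B2) \<le> n * ln B2"
      using m B2 by (auto simp: card_Diff_singleton intro!: mult_right_mono)
    with 1 have "sum b ({..<n}-{m}) \<le> Th * real n"
      by (simp add: b_def sum_subtractf Th_def algebra_simps)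
    with b m(1) show ?thesis by (intro exI[of _ m] conjI exI[of _ b]) auto
  qed
  show ?thesis by (intro exI[of _ Th] conjI allI impI Th) (rule main; assumption)
qed

text \<open>The derivative is a product of distances to critical points. Each linear factor
  contributes at most one exceptional time to \<open>E\<close>, and at the remaining times the
  losses add; \<open>\<beta>\<close> is the loss from the leading coefficient.\<close>

lemma orbit_derivative_lower_bound:
  fixes q :: "complex poly"
  assumes deg: "degree q \<ge> 2" and eps: "\<epsilon> > 0"
  shows "\<exists>Th\<ge>0. \<forall>n y. (\<forall>l. Suc l < n \<longrightarrow> y (Suc l) = poly q (y l)) \<longrightarrow>
     (\<forall>l<n. norm (y l) \<le> B) \<longrightarrow> (\<forall>l<n. avoids_periodic_critical q \<epsilon> (y l)) \<longrightarrow>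
     (\<exists>E b. E \<subseteq> {..<n} \<and> card E \<le> degree q \<and>
       (\<forall>l\<in>{..<n}-E. 0 \<le> b l \<and> exp (- b l) \<le> norm (poly (pderiv q) (y l))) \<and> sum b ({..<n}-E) \<le> Th * real n)"
proof -
  define D where "D = degree (pderiv q)"
  define L where "L = lead_coeff (pderiv q)"
  have D: "D \<le> degree q" by (simp add: D_def degree_pderiv)
  have "degree (pderiv q) \<noteq> 0" using deg by (simp add: degree_pderiv)
  then have L: "L \<noteq> 0" by (auto simp: L_def)
  obtain root where root: "smult L (\<Prod>i<D. [:-root i, 1:]) = pderiv q"
    unfolding L_def D_def using complex_poly_decompose' .
  have fact: "poly (pderiv q) z = L * (\<Prod>i<D. z - root i)" for z
    by (subst root[symmetric]) (simp add: poly_prod)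
  have "poly (pderiv q) (root i) = 0" if "i < D" for i using that by (auto simp: fact)
  then have "\<forall>i\<in>{..<D}. \<exists>Th\<ge>0. \<forall>n y. 0 < n \<longrightarrow> (\<forall>l. Suc l < n \<longrightarrow> y (Suc l) = poly q (y l)) \<longrightarrow>
     (\<forall>l<n. norm (y l) \<le> B) \<longrightarrow> (\<forall>l<n. avoids_periodic_critical q \<epsilon> (y l)) \<longrightarrow>
     (\<exists>m<n. \<exists>b. (\<forall>l\<in>{..<n}-{m}. 0 \<le> b l \<and> exp (- b l) \<le> dist (y l) (root i)) \<and> sum b ({..<n}-{m}) \<le> Th * real n)"
    using orbit_distance_to_critical_point[OF _ eps] by blast
  from bchoice[OF this] obtain Th where Th: "\<forall>i\<in>{..<D}. 0 \<le> Th i \<and> (\<forall>n y. 0 < n \<longrightarrow> (\<forall>l. Suc l < n \<longrightarrow> y (Suc l) = poly q (y l)) \<longrightarrow>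
     (\<forall>l<n. norm (y l) \<le> B) \<longrightarrow> (\<forall>l<n. avoids_periodic_critical q \<epsilon> (y l)) \<longrightarrow>
     (\<exists>m<n. \<exists>b. (\<forall>l\<in>{..<n}-{m}. 0 \<le> b l \<and> exp (- b l) \<le> dist (y l) (root i)) \<and> sum b ({..<n}-{m}) \<le> Th i * real n))"
    by (elim exE)
  have Th0: "0 \<le> Th i" if "i < D" for i using Th[THEN bspec, of i] that by simp
  define \<beta> where "\<beta> = max 0 (- ln (norm L))"
  have \<beta>: "0 \<le> \<beta>" "exp (- \<beta>) \<le> norm L"
  proof -
    have "exp (-\<beta>) \<le> exp (ln (norm L))" by (simp add: \<beta>_def)
    then show "exp (- \<beta>) \<le> norm L" using L by simp
  qed (simp add: \<beta>_def)
  define T where "T = \<beta> + (\<Sum>i<D. Th i)"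
  have T: "0 \<le> T" using \<beta> Th0 by (auto simp: T_def intro!: add_nonneg_nonneg sum_nonneg)
  have main: "\<exists>E b. E \<subseteq> {..<n} \<and> card E \<le> degree q \<and>
       (\<forall>l\<in>{..<n}-E. 0 \<le> b l \<and> exp (- b l) \<le> norm (poly (pderiv q) (y l))) \<and> sum b ({..<n}-E) \<le> T * real n"
    if orb: "\<forall>l. Suc l < n \<longrightarrow> y (Suc l) = poly q (y l)"
      and bd: "\<forall>l<n. norm (y l) \<le> B" and av: "\<forall>l<n. avoids_periodic_critical q \<epsilon> (y l)" for n y
  proof (cases "n = 0")
    case True then show ?thesis by auto
  next
    case False
    then have n: "0 < n" by simp
    have "\<forall>i\<in>{..<D}. \<exists>mb. fst mb < n \<and> (\<forall>l\<in>{..<n}-{fst mb}. 0 \<le> snd mb l \<and> exp (- snd mb l) \<le> dist (y l) (root i))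
        \<and> sum (snd mb) ({..<n}-{fst mb}) \<le> Th i * real n"
    proof
      fix i assume i: "i \<in> {..<D}"
      from bspec[OF Th i] have *: "\<forall>n y. 0 < n \<longrightarrow> (\<forall>l. Suc l < n \<longrightarrow> y (Suc l) = poly q (y l)) \<longrightarrow>
     (\<forall>l<n. norm (y l) \<le> B) \<longrightarrow> (\<forall>l<n. avoids_periodic_critical q \<epsilon> (y l)) \<longrightarrow>
     (\<exists>m<n. \<exists>b. (\<forall>l\<in>{..<n}-{m}. 0 \<le> b l \<and> exp (- b l) \<le> dist (y l) (root i)) \<and> sum b ({..<n}-{m}) \<le> Th i * real n)"
        by (rule conjunct2)
      have "\<exists>m<n. \<exists>b. (\<forall>l\<in>{..<n}-{m}. 0 \<le> b l \<and> exp (- b l) \<le> dist (y l) (root i)) \<and> sum b ({..<n}-{m}) \<le> Th i * real n"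
        by (rule *[THEN spec, THEN spec, THEN mp, THEN mp, THEN mp, THEN mp, OF n orb bd av])
      then obtain m b where "m < n" "\<forall>l\<in>{..<n}-{m}. 0 \<le> b l \<and> exp (- b l) \<le> dist (y l) (root i)"
        "sum b ({..<n}-{m}) \<le> Th i * real n" by blast
      then show "\<exists>mb. fst mb < n \<and> (\<forall>l\<in>{..<n}-{fst mb}. 0 \<le> snd mb l \<and> exp (- snd mb l) \<le> dist (y l) (root i))
        \<and> sum (snd mb) ({..<n}-{fst mb}) \<le> Th i * real n"
        by (intro exI[of _ "(m, b)"]) simp
    qed
    from bchoice[OF this] obtain mb where mb': "\<forall>i\<in>{..<D}. fst (mb i) < n \<and>
        (\<forall>l\<in>{..<n}-{fst (mb i)}. 0 \<le> snd (mb i) l \<and> exp (- snd (mb i) l) \<le> dist (y l) (root i))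
        \<and> sum (snd (mb i)) ({..<n}-{fst (mb i)}) \<le> Th i * real n" by (elim exE)
    have mb: "fst (mb i) < n"
        "l \<in> {..<n}-{fst (mb i)} \<Longrightarrow> 0 \<le> snd (mb i) l \<and> exp (- snd (mb i) l) \<le> dist (y l) (root i)"
        "sum (snd (mb i)) ({..<n}-{fst (mb i)}) \<le> Th i * real n" if "i < D" for i l
      using mb'[THEN bspec, of i] that by auto
    define E where "E = (\<lambda>i. fst (mb i)) ` {..<D}"
    define b where "b l = \<beta> + (\<Sum>i<D. snd (mb i) l)" for l
    have E: "E \<subseteq> {..<n}" using mb(1) by (auto simp: E_def)
    have cE: "card E \<le> degree q" using card_image_le[of "{..<D}" "\<lambda>i. fst (mb i)"] D by (simp add: E_def)
    have off: "l \<in> {..<n}-{fst (mb i)}" if "l \<in> {..<n}-E" "i < D" for l i using that by (auto simp: E_def)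
    have 1: "0 \<le> b l \<and> exp (- b l) \<le> norm (poly (pderiv q) (y l))" if l: "l \<in> {..<n}-E" for l
    proof
      show "0 \<le> b l" unfolding b_def using \<beta> mb(2) off[OF l]
        by (intro add_nonneg_nonneg sum_nonneg) auto
      have "- b l = - \<beta> + (\<Sum>i<D. - snd (mb i) l)" by (simp add: b_def sum_negf)
      then have "exp (- b l) = exp (-\<beta>) * (\<Prod>i<D. exp (- snd (mb i) l))"
        by (simp only: exp_add exp_sum finite_lessThan)
      also have "\<dots> \<le> norm L * (\<Prod>i<D. dist (y l) (root i))"
        using \<beta> mb(2) off[OF l] by (intro mult_mono prod_mono prod_nonneg) auto
      also have "\<dots> = norm (poly (pderiv q) (y l))"
        by (simp add: fact norm_mult prod_norm[symmetric] dist_norm)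
      finally show "exp (- b l) \<le> norm (poly (pderiv q) (y l))" .
    qed
    have "sum b ({..<n}-E) = (\<Sum>l\<in>{..<n}-E. \<beta>) + (\<Sum>l\<in>{..<n}-E. \<Sum>i<D. snd (mb i) l)"
      by (simp add: b_def sum.distrib)
    also have "(\<Sum>l\<in>{..<n}-E. \<Sum>i<D. snd (mb i) l) = (\<Sum>i<D. sum (snd (mb i)) ({..<n}-E))"
      by (rule sum.swap)
    \<comment> \<open>Since losses are nonnegative, the times that \<open>E\<close> excludes on
      account of other critical points may be put back.\<close>
    also have "\<dots> \<le> (\<Sum>i<D. sum (snd (mb i)) ({..<n}-{fst (mb i)}))"
      using mb(2) by (intro sum_mono sum_mono2) (auto simp: E_def)
    also have "\<dots> \<le> (\<Sum>i<D. Th i * real n)" using mb(3) by (intro sum_mono) auto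
    also have "(\<Sum>l\<in>{..<n}-E. \<beta>) \<le> n * \<beta>"
      using \<beta> card_mono[of "{..<n}" "{..<n}-E"] by (auto intro!: mult_right_mono)
    finally have "sum b ({..<n}-E) \<le> T * real n"
      by (simp add: T_def algebra_simps sum_distrib_left sum_distrib_right)
    with E cE 1 show ?thesis by (intro exI[of _ E] conjI exI[of _ b]) auto
  qed
  show ?thesis by (intro exI[of _ T] conjI allI impI T) (rule main; assumption)
qed

section \<open>Bulging Fatou components\<close>

text \<open>Stronger than normality: limits are uniform on all of \<open>V\<close>, and only
  exponents tending to infinity occur. In this form the property passes to preimages under iterates
  and to the slice over \<open>0\<close> by mere substitution.\<close>

definition uniformly_tame_on :: "('a::real_normed_vector \<Rightarrow> 'a) \<Rightarrow> 'a set \<Rightarrow> bool" where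
  "uniformly_tame_on g V \<longleftrightarrow> (\<forall>m::nat\<Rightarrow>nat. strict_mono m \<longrightarrow> (\<exists>r::nat\<Rightarrow>nat. strict_mono r \<and>
     ((\<exists>h. uniform_limit V (\<lambda>i. g ^^ (m (r i))) h sequentially) \<or>
      (\<forall>B. \<forall>\<^sub>F i in sequentially. \<forall>x\<in>V. norm ((g ^^ (m (r i))) x) > B))))"

text \<open>A sequence in \<open>iterates g\<close> may repeat or permute exponents, while tameness
  speaks of increasing ones; this reduces the former to the latter or to a constant
  sequence.\<close>

lemma nat_seq_constant_or_strict_mono_subseq:
  fixes m :: "nat \<Rightarrow> nat"
  shows "\<exists>r::nat\<Rightarrow>nat. strict_mono r \<and> ((\<exists>N. \<forall>i. m (r i) = N) \<or> strict_mono (\<lambda>i. m (r i)))"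
proof (cases "\<exists>N. infinite {i. m i = N}")
  case True
  then obtain N where "infinite {i. m i = N}" by blast
  from infinite_enumerate[OF this] obtain r :: "nat \<Rightarrow> nat" where "strict_mono r" "\<forall>i. m (r i) = N" by auto
  then show ?thesis by (intro exI[of _ r] conjI disjI1 exI[of _ N])
next
  case False
  have fin: "finite {i. m i \<le> N}" for N
  proof -
    have "{i. m i \<le> N} = (\<Union>k\<in>{..N}. {i. m i = k})" by auto
    with False show ?thesis by simp
  qed
  have ex: "\<exists>j. i < j \<and> m i < m j" for i
  proof -
    have "finite ({..i} \<union> {k. m k \<le> m i})" using fin by simp
    then obtain j where "j \<notin> {..i} \<union> {k. m k \<le> m i}"
      using ex_new_if_finite infinite_UNIV_nat by blast
    then show ?thesis by (intro exI[of _ j]) auto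
  qed
  have "\<exists>r::nat\<Rightarrow>nat. \<forall>n. True \<and> (r n < r (Suc n) \<and> m (r n) < m (r (Suc n)))"
    by (rule dependent_nat_choice[of "\<lambda>_ _. True" "\<lambda>_ i j. i < j \<and> m i < m j"]) (use ex in auto)
  then show ?thesis by (auto simp: strict_mono_Suc_iff)
qed

lemma uniformly_tame_imp_normal:
  assumes tame: "uniformly_tame_on g V" and V: "connected V"
  shows "normal_family_on V (iterates g)"
  unfolding normal_family_on_def
proof (intro allI impI)
  fix f :: "nat \<Rightarrow> 'a \<Rightarrow> 'a" assume "range f \<subseteq> iterates g"
  then have "\<forall>i. \<exists>k. f i = g ^^ k" by (auto simp: iterates_def)
  then obtain m where m: "\<And>i. f i = g ^^ m i" by metis
  have CV: "C = V" if "C \<in> components V" for C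
    using that V by (metis connected_eq_components_subset_sing singletonD subsetD)
  obtain r :: "nat \<Rightarrow> nat" where r: "strict_mono r" "(\<exists>N. \<forall>i. m (r i) = N) \<or> strict_mono (\<lambda>i. m (r i))"
    using nat_seq_constant_or_strict_mono_subseq[of m] by blast
  from r(2) show "\<exists>r. strict_mono r \<and> (\<forall>C\<in>components V.
      converges_loc_uniformly_on C (f \<circ> r) \<or> diverges_loc_uniformly_on C (f \<circ> r))"
  proof
    assume "\<exists>N. \<forall>i. m (r i) = N"
    then obtain N where "\<And>i. (f \<circ> r) i = g ^^ N" using m by auto
    then have "f \<circ> r = (\<lambda>i. g ^^ N)" by auto
    then have "converges_loc_uniformly_on V (f \<circ> r)"
      unfolding converges_loc_uniformly_on_def by (auto intro!: exI[of _ "g ^^ N"] uniform_limit_const)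
    with CV r(1) show ?thesis by blast
  next
    assume "strict_mono (\<lambda>i. m (r i))"
    with tame obtain s where s: "strict_mono s"
      "(\<exists>h. uniform_limit V (\<lambda>i. g ^^ (m (r (s i)))) h sequentially) \<or>
      (\<forall>B. \<forall>\<^sub>F i in sequentially. \<forall>x\<in>V. norm ((g ^^ (m (r (s i)))) x) > B)"
      unfolding uniformly_tame_on_def by blast
    have e: "f \<circ> (r \<circ> s) = (\<lambda>i. g ^^ (m (r (s i))))" by (auto simp: m)
    have "converges_loc_uniformly_on V (f \<circ> (r \<circ> s)) \<or> diverges_loc_uniformly_on V (f \<circ> (r \<circ> s))"
      using s(2)
    proof
      assume "\<exists>h. uniform_limit V (\<lambda>i. g ^^ (m (r (s i)))) h sequentially"
      then show ?thesis unfolding converges_loc_uniformly_on_def e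
        by (blast intro: uniform_limit_on_subset)
    next
      assume *: "\<forall>B. \<forall>\<^sub>F i in sequentially. \<forall>x\<in>V. norm ((g ^^ (m (r (s i)))) x) > B"
      have "diverges_loc_uniformly_on V (\<lambda>i. g ^^ (m (r (s i))))"
        unfolding diverges_loc_uniformly_on_def
      proof (intro allI impI)
        fix K B assume "compact K \<and> K \<subseteq> V"
        then show "\<forall>\<^sub>F n in sequentially. \<forall>x\<in>K. norm ((g ^^ (m (r (s n)))) x) > B"
          using *[rule_format, of B] by (auto elim!: eventually_mono)
      qed
      then show ?thesis unfolding e by blast
    qed
    moreover have "strict_mono (r \<circ> s)" using r s by (simp add: strict_mono_o)
    ultimately show ?thesis using CV by blast
  qed
qed

lemma uniformly_tame_pullback:
  assumes tame: "uniformly_tame_on g W" and VW: "(g ^^ n) ` V \<subseteq> W"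
  shows "uniformly_tame_on g V"
  unfolding uniformly_tame_on_def
proof (intro allI impI)
  fix m :: "nat \<Rightarrow> nat" assume m: "strict_mono m"
  \<comment> \<open>\<open>m'\<close> removes the \<open>n\<close> applications of \<open>g\<close>
    that carry \<open>V\<close> into \<open>W\<close>. The truncated subtraction is exact because
    \<open>n \<le> m (i + n)\<close>.\<close>
  define m' where "m' i = m (i + n) - n" for i
  have ge: "n \<le> m (i + n)" for i using strict_mono_imp_increasing[OF m, of "i+n"] by simp
  have "strict_mono m'"
    unfolding m'_def strict_mono_def
  proof (intro allI impI)
    fix i j :: nat assume "i < j"
    then have "m (i+n) < m (j+n)" using m by (simp add: strict_mono_def)
    then show "m (i+n) - n < m (j+n) - n" using ge[of i] by linarith
  qed
  then obtain r where r: "strict_mono r"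
    "(\<exists>h. uniform_limit W (\<lambda>i. g ^^ (m' (r i))) h sequentially) \<or>
      (\<forall>B. \<forall>\<^sub>F i in sequentially. \<forall>x\<in>W. norm ((g ^^ (m' (r i))) x) > B)"
    using tame unfolding uniformly_tame_on_def by blast
  define s where "s i = r i + n" for i
  have s: "strict_mono s" using r(1) by (auto simp: s_def strict_mono_def)
  have e: "(g ^^ (m (s i))) x = (g ^^ (m' (r i))) ((g ^^ n) x)" for i x
  proof -
    have "m (s i) = m' (r i) + n" using ge[of "r i"] by (simp add: s_def m'_def)
    then show ?thesis by (simp add: funpow_add)
  qed
  have inW: "(g ^^ n) x \<in> W" if "x \<in> V" for x using VW that by blast
  from r(2) have "(\<exists>h. uniform_limit V (\<lambda>i. g ^^ (m (s i))) h sequentially) \<or>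
      (\<forall>B. \<forall>\<^sub>F i in sequentially. \<forall>x\<in>V. norm ((g ^^ (m (s i))) x) > B)"
  proof (elim disjE exE)
    fix h assume h: "uniform_limit W (\<lambda>i. g ^^ (m' (r i))) h sequentially"
    have "uniform_limit V (\<lambda>i. g ^^ (m (s i))) (\<lambda>x. h ((g ^^ n) x)) sequentially"
      unfolding uniform_limit_iff e
    proof (intro allI impI)
      fix \<epsilon> :: real assume "\<epsilon> > 0"
      with h have "\<forall>\<^sub>F i in sequentially. \<forall>x\<in>W. dist ((g ^^ (m' (r i))) x) (h x) < \<epsilon>"
        unfolding uniform_limit_iff by blast
      then show "\<forall>\<^sub>F i in sequentially. \<forall>x\<in>V. dist ((g ^^ (m' (r i))) ((g^^n) x)) (h ((g^^n) x)) < \<epsilon>"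
        by eventually_elim (use inW in blast)
    qed
    then show ?thesis by blast
  next
    assume *: "\<forall>B. \<forall>\<^sub>F i in sequentially. \<forall>x\<in>W. norm ((g ^^ (m' (r i))) x) > B"
    have "\<forall>\<^sub>F i in sequentially. \<forall>x\<in>V. norm ((g ^^ (m (s i))) x) > B" for B
      using *[rule_format, of B] unfolding e by eventually_elim (use inW in blast)
    then show ?thesis by blast
  qed
  with s show "\<exists>r. strict_mono r \<and> ((\<exists>h. uniform_limit V (\<lambda>i. g ^^ (m (r i))) h sequentially) \<or>
      (\<forall>B. \<forall>\<^sub>F i in sequentially. \<forall>x\<in>V. norm ((g ^^ (m (r i))) x) > B))" by (intro exI[of _ s] conjI)
qed

lemma subset_Fatou_set:
  assumes "open V" "connected V" "V \<subseteq> X" "(g ^^ n) ` V \<subseteq> W" "uniformly_tame_on g W"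
  shows "V \<subseteq> Fatou_set X g"
proof -
  have "normal_family_on V (iterates g)"
    using assms(2) uniformly_tame_pullback[OF assms(5,4)] by (intro uniformly_tame_imp_normal)
  with assms(1,3) show ?thesis unfolding Fatou_set_def by blast
qed

lemma skew_funpow_0: "(skew lam f ^^ n) (0, z) = (0, (f 0 ^^ n) z)"
  by (induction n) (auto simp: skew_def)

lemma fst_skew_funpow: "fst ((skew lam f ^^ n) x) = lam ^ n * fst x"
  by (induction n) (auto simp: skew_def split: prod.split)

lemma uniformly_tame_slice:
  assumes tame: "uniformly_tame_on (skew lam f) W"
  shows "uniformly_tame_on (f 0) {z. (0, z) \<in> W}"
  unfolding uniformly_tame_on_def
proof (intro allI impI)
  fix m :: "nat \<Rightarrow> nat" assume "strict_mono m"
  with tame obtain r where r: "strict_mono r"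
    "(\<exists>h. uniform_limit W (\<lambda>i. skew lam f ^^ (m (r i))) h sequentially) \<or>
      (\<forall>B. \<forall>\<^sub>F i in sequentially. \<forall>x\<in>W. norm ((skew lam f ^^ (m (r i))) x) > B)"
    unfolding uniformly_tame_on_def by blast
  let ?S = "{z. (0, z) \<in> W}"
  from r(2) have "(\<exists>h. uniform_limit ?S (\<lambda>i. f 0 ^^ (m (r i))) h sequentially) \<or>
      (\<forall>B. \<forall>\<^sub>F i in sequentially. \<forall>x\<in>?S. norm ((f 0 ^^ (m (r i))) x) > B)"
  proof (elim disjE exE)
    fix h assume h: "uniform_limit W (\<lambda>i. skew lam f ^^ (m (r i))) h sequentially"
    have "uniform_limit ?S (\<lambda>i. f 0 ^^ (m (r i))) (\<lambda>z. snd (h (0, z))) sequentially"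
      unfolding uniform_limit_iff
    proof (intro allI impI)
      fix \<epsilon> :: real assume "\<epsilon> > 0"
      with h have "\<forall>\<^sub>F i in sequentially. \<forall>x\<in>W. dist ((skew lam f ^^ (m (r i))) x) (h x) < \<epsilon>"
        unfolding uniform_limit_iff by blast
      then show "\<forall>\<^sub>F i in sequentially. \<forall>z\<in>?S. dist ((f 0 ^^ (m (r i))) z) (snd (h (0, z))) < \<epsilon>"
      proof eventually_elim
        case (elim i)
        show ?case
        proof
          fix z assume "z \<in> ?S"
          with elim have "dist ((skew lam f ^^ (m (r i))) (0, z)) (h (0, z)) < \<epsilon>" by blast
          then show "dist ((f 0 ^^ (m (r i))) z) (snd (h (0, z))) < \<epsilon>"
            using dist_snd_le[of "(skew lam f ^^ (m (r i))) (0, z)" "h (0, z)"] by (simp add: skew_funpow_0)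
        qed
      qed
    qed
    then show ?thesis by blast
  next
    assume *: "\<forall>B. \<forall>\<^sub>F i in sequentially. \<forall>x\<in>W. norm ((skew lam f ^^ (m (r i))) x) > B"
    have "\<forall>\<^sub>F i in sequentially. \<forall>z\<in>?S. norm ((f 0 ^^ (m (r i))) z) > B" for B
      using *[rule_format, of B]
    proof eventually_elim
      case (elim i)
      show ?case
      proof
        fix z assume "z \<in> ?S"
        with elim have "norm ((skew lam f ^^ (m (r i))) (0, z)) > B" by blast
        then show "norm ((f 0 ^^ (m (r i))) z) > B" by (simp add: skew_funpow_0 norm_Pair)
      qed
    qed
    then show ?thesis by blast
  qed
  with r(1) show "\<exists>r. strict_mono r \<and> ((\<exists>h. uniform_limit ?S (\<lambda>i. f 0 ^^ (m (r i))) h sequentially) \<or>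
      (\<forall>B. \<forall>\<^sub>F i in sequentially. \<forall>x\<in>?S. norm ((f 0 ^^ (m (r i))) x) > B))" by (intro exI[of _ r] conjI)
qed

text \<open>Iterates with different residues modulo \<open>k\<close> approach different points of
  the cycle. By pigeonhole a subsequence has constant residue \<open>e\<close>, and along it the
  limit is the constant \<open>(g ^^ e) a\<close>.\<close>

lemma uniformly_tame_of_periodic_attractor:
  fixes g :: "'a::real_normed_vector \<Rightarrow> 'a"
  assumes k: "0 < (k::nat)" and cont: "\<And>s. isCont (g ^^ s) a"
    and lim: "s \<longlonglongrightarrow> (0::real)" and bound: "\<And>n x. x \<in> W \<Longrightarrow> dist ((g ^^ (k * n)) x) a \<le> s n"
  shows "uniformly_tame_on g W"
  unfolding uniformly_tame_on_def
proof (intro allI impI)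
  fix m :: "nat \<Rightarrow> nat" assume m: "strict_mono m"
  have "finite ((\<lambda>i. m i mod k) ` UNIV)"
    by (rule finite_subset[of _ "{..<k}"]) (use k in auto)
  then obtain i0 where "infinite {i. m i mod k = m i0 mod k}"
    using pigeonhole_infinite[of UNIV "\<lambda>i. m i mod k"] by auto
  from infinite_enumerate[OF this] obtain r :: "nat \<Rightarrow> nat" where r: "strict_mono r" "\<And>i. m (r i) mod k = m i0 mod k"
    by auto
  define e where "e = m i0 mod k"
  have dec: "(g ^^ (m (r i))) x = (g ^^ e) ((g ^^ (k * (m (r i) div k))) x)" for i x
  proof -
    have "m (r i) = e + k * (m (r i) div k)" using r(2)[of i] by (metis e_def mod_mult_div_eq)
    then show ?thesis by (metis funpow_add comp_apply)
  qed
  have "uniform_limit W (\<lambda>i. g ^^ (m (r i))) (\<lambda>x. (g ^^ e) a) sequentially"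
    unfolding uniform_limit_iff
  proof (intro allI impI)
    fix \<epsilon> :: real assume "\<epsilon> > 0"
    with cont[of e] obtain d where d: "d > 0" "\<And>x. dist x a < d \<Longrightarrow> dist ((g ^^ e) x) ((g ^^ e) a) < \<epsilon>"
      unfolding continuous_at_eps_delta by blast
    from lim d(1) have "\<forall>\<^sub>F n in sequentially. s n < d"
      by (rule order_tendstoD)
    then obtain N where N: "\<And>n. n \<ge> N \<Longrightarrow> s n < d" by (auto simp: eventually_sequentially)
    show "\<forall>\<^sub>F i in sequentially. \<forall>x\<in>W. dist ((g ^^ (m (r i))) x) ((g ^^ e) a) < \<epsilon>"
      unfolding eventually_sequentially
    proof (intro exI allI impI ballI)
      fix i x assume i: "k * N \<le> i" and x: "x \<in> W"
      have "strict_mono (\<lambda>i. m (r i))" using m r(1) by (auto simp: strict_mono_def)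
      from strict_mono_imp_increasing[OF this, of i] i have "k * N \<le> m (r i)" by simp
      then have "N \<le> m (r i) div k" using k by (simp add: less_eq_div_iff_mult_less_eq mult.commute)
      with N bound[OF x] have "dist ((g ^^ (k * (m (r i) div k))) x) a < d" by (meson le_less_trans)
      with d(2) show "dist ((g ^^ (m (r i))) x) ((g ^^ e) a) < \<epsilon>" unfolding dec by blast
    qed
  qed
  with r(1) show "\<exists>r. strict_mono r \<and> ((\<exists>h. uniform_limit W (\<lambda>i. g ^^ (m (r i))) h sequentially) \<or>
      (\<forall>B. \<forall>\<^sub>F i in sequentially. \<forall>x\<in>W. norm ((g ^^ (m (r i))) x) > B))" by (intro exI[of _ r] conjI disjI1 exI)
qed

text \<open>A normality argument on the components of the neighbourhoods in \<open>step\<close> shows that \<open>A\<close> is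
  relatively closed in \<open>U\<close>.\<close>

lemma Fatou_component_subset:
  fixes g :: "'a::real_normed_vector \<Rightarrow> 'a"
  assumes U: "U \<in> Fatou_components UNIV g" and A: "open A" "A \<inter> U \<noteq> {}"
    and step: "\<And>C. \<lbrakk>open C; connected C; C \<inter> A \<noteq> {};
        \<And>m::nat\<Rightarrow>nat. \<exists>r::nat\<Rightarrow>nat. strict_mono r \<and> (converges_loc_uniformly_on C (\<lambda>i. g ^^ (m (r i))) \<or>
                                diverges_loc_uniformly_on C (\<lambda>i. g ^^ (m (r i))))\<rbrakk> \<Longrightarrow> C \<subseteq> A"
  shows "U \<subseteq> A"
proof -
  have UF: "U \<subseteq> Fatou_set UNIV g" "connected U"
    using U unfolding Fatou_components_def by (auto dest: in_components_subset in_components_connected)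
  have closed: "z \<in> A" if z: "z \<in> U" "z \<in> closure A" for z
  proof -
    obtain W where W: "open W" "normal_family_on W (iterates g)" "z \<in> W"
      using z(1) UF unfolding Fatou_set_def by blast
    define C where "C = connected_component_set W z"
    have C: "C \<in> components W" "open C" "connected C" "z \<in> C"
      using W by (auto simp: C_def components_def open_connected_component)
    have "C \<inter> A \<noteq> {}" using z(2) C(2,4) open_Int_closure_eq_empty[of C A] by blast
    moreover have "\<exists>r::nat\<Rightarrow>nat. strict_mono r \<and> (converges_loc_uniformly_on C (\<lambda>i. g ^^ (m (r i))) \<or>
                                diverges_loc_uniformly_on C (\<lambda>i. g ^^ (m (r i))))" for m :: "nat \<Rightarrow> nat"
    proof -
      have "range (\<lambda>i. g ^^ (m i)) \<subseteq> iterates g" by (auto simp: iterates_def)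
      with W(2) C(1) show ?thesis unfolding normal_family_on_def by (fastforce simp: o_def)
    qed
    ultimately have "C \<subseteq> A" by (intro step C(2,3))
    with C(4) show ?thesis by blast
  qed
  have "U \<subseteq> A \<union> - closure A" using closed by blast
  moreover have "A \<inter> - closure A \<inter> U = {}" using closure_subset by blast
  ultimately have "A \<inter> U = {} \<or> - closure A \<inter> U = {}"
    using connectedD[OF UF(2) A(1), of "- closure A"] by auto
  with A(2) \<open>U \<subseteq> A \<union> - closure A\<close> show ?thesis by blast
qed

section \<open>Basins of infinity and of superattracting cycles\<close>

lemma continuous_on_funpow:
  assumes "continuous_on X g" "g ` X \<subseteq> X"
  shows "continuous_on X (g ^^ n)" "(g ^^ n) ` X \<subseteq> X"
proof (induction n)
  case (Suc n)
  { case 1 show ?case using Suc assms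
      by (auto intro!: continuous_on_compose2[OF assms(1)] simp: o_def) }
  { case 2 show ?case using Suc assms by auto }
qed (auto simp: id_def)

text \<open>On a connected set of normality with one escaping point, a subsequence of the iterates
  cannot converge; hence it diverges everywhere, and all points of the set escape.\<close>

lemma Fatou_component_in_basin_of_infinity:
  fixes p :: "complex \<Rightarrow> complex"
  assumes U: "U \<in> Fatou_components UNIV p" and sub: "{z. norm z > R} \<inter> U \<noteq> {}"
    and R: "R > 0" and esc: "\<And>z. norm z > R \<Longrightarrow> norm (p z) \<ge> 2 * norm z" and cont: "continuous_on UNIV p"
    and z: "z \<in> U"
  shows "\<exists>n. norm ((p ^^ n) z) > R"
proof -
  define A where "A = (\<Union>n. (p ^^ n) -` {w. norm w > R})"
  have opn: "open {w::complex. norm w > R}" by (intro open_Collect_less continuous_intros)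
  have grow: "norm ((p ^^ n) w) \<ge> 2 ^ n * R \<and> norm ((p ^^ n) w) > R" if "norm w > R" for n w
  proof (induction n)
    case (Suc n)
    have "2 * norm ((p ^^ n) w) \<le> norm (p ((p ^^ n) w))" using Suc esc by blast
    with Suc R show ?case by auto
  qed (use that in simp)
  have "U \<subseteq> A"
  proof (rule Fatou_component_subset[OF U])
    show "open A" unfolding A_def using continuous_on_funpow[OF cont] opn
      by (intro open_UN ballI open_vimage) auto
    have "w \<in> A" if "norm w > R" for w
      unfolding A_def by (rule UN_I[of 0]) (use that in auto)
    then show "A \<inter> U \<noteq> {}" using sub by blast
  next
    fix C assume C: "C \<inter> A \<noteq> {}" and nrm: "\<And>m::nat\<Rightarrow>nat. \<exists>r::nat\<Rightarrow>nat. strict_mono r \<and> (converges_loc_uniformly_on C (\<lambda>i. p ^^ (m (r i))) \<or>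
                                diverges_loc_uniformly_on C (\<lambda>i. p ^^ (m (r i))))"
    obtain v n where v: "v \<in> C" "norm ((p ^^ n) v) > R" using C unfolding A_def by auto
    from nrm[of "\<lambda>i. i"] obtain r :: "nat \<Rightarrow> nat"
      where r': "strict_mono r \<and> (converges_loc_uniformly_on C (\<lambda>i. p ^^ (r i)) \<or>
                                diverges_loc_uniformly_on C (\<lambda>i. p ^^ (r i)))" ..
    note r = conjunct1[OF r'] conjunct2[OF r']
    have "\<not> converges_loc_uniformly_on C (\<lambda>i. p ^^ (r i))"
    proof
      assume "converges_loc_uniformly_on C (\<lambda>i. p ^^ (r i))"
      then obtain h where "\<forall>K. compact K \<and> K \<subseteq> C \<longrightarrow> uniform_limit K (\<lambda>i. p ^^ (r i)) h sequentially"
        unfolding converges_loc_uniformly_on_def ..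
      from this[rule_format, of "{v}"] have "(\<lambda>i. (p ^^ (r i)) v) \<longlonglongrightarrow> h v"
        using v(1) by simp
      then have "Bseq (\<lambda>i. (p ^^ (r i)) v)" by (rule convergentI[THEN convergent_imp_Bseq])
      then obtain K where K: "\<And>i. norm ((p ^^ (r i)) v) \<le> K" by (auto simp: Bseq_def)
      obtain j where j: "K / R < 2 ^ j" using real_arch_pow[of 2 "K/R"] by auto
      have "r (j + n) \<ge> j + n" using strict_mono_imp_increasing[OF r(1)] .
      then obtain l where l: "r (j + n) = l + n" "j \<le> l" 
        by (intro that[of "r (j + n) - n"]) auto
      have "K < 2 ^ j * R" using j R by (simp add: divide_simps)
      also have "\<dots> \<le> 2 ^ l * R" using l(2) R by (intro mult_right_mono power_increasing) auto
      also have "\<dots> \<le> norm ((p ^^ l) ((p ^^ n) v))" using grow[OF v(2)] by blast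
      also have "\<dots> = norm ((p ^^ (r (j+n))) v)" unfolding l(1) by (simp add: funpow_add)
      also have "\<dots> \<le> K" by (rule K)
      finally show False by simp
    qed
    with r(2) have div: "diverges_loc_uniformly_on C (\<lambda>i. p ^^ (r i))" by blast
    show "C \<subseteq> A"
    proof
      fix w assume "w \<in> C"
      then have "\<forall>\<^sub>F i in sequentially. \<forall>x\<in>{w}. norm ((p ^^ (r i)) x) > R"
        using div[unfolded diverges_loc_uniformly_on_def, rule_format, of "{w}" R] by simp
      then obtain i where "norm ((p ^^ (r i)) w) > R" by (auto simp: eventually_sequentially)
      then show "w \<in> A" unfolding A_def by blast
    qed
  qed
  with z show ?thesis unfolding A_def by auto
qed

text \<open>A convergent subsequence has a holomorphic limit that equals \<open>c\<close> on the
  open set \<open>C \<inter> A\<close>, hence on all of \<open>C\<close> by the identity theorem.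
  Only multiples of \<open>k\<close> are used, so that the limit is \<open>c\<close> and not another
  point of the cycle.\<close>

lemma Fatou_component_in_superattracting_basin:
  fixes p :: "complex \<Rightarrow> complex"
  assumes U: "U \<in> Fatou_components UNIV p" and sub: "c \<in> U" and eps: "\<epsilon> > 0"
    and contr: "\<And>z. z \<in> ball c \<epsilon> \<Longrightarrow> dist ((p ^^ k) z) c \<le> 1/2 * dist z c"
    and hol: "\<And>n. (p ^^ n) holomorphic_on UNIV"
    and z: "z \<in> U"
  shows "\<exists>n. (p ^^ n) z \<in> ball c \<epsilon>"
proof -
  define A where "A = (\<Union>n. (p ^^ (k * n)) -` ball c \<epsilon>)"
  have conv: "(\<lambda>n. (p ^^ (k * n)) v) \<longlonglongrightarrow> c" if "v \<in> A" for v
  proof -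
    obtain n0 where n0: "(p ^^ (k * n0)) v \<in> ball c \<epsilon>" using \<open>v \<in> A\<close> unfolding A_def by auto
    define u where "u = (p ^^ (k * n0)) v"
    have it: "(p ^^ (k * n)) u \<in> ball c \<epsilon> \<and> dist ((p ^^ (k * n)) u) c \<le> (1/2)^n * \<epsilon>" for n
    proof (induction n)
      case 0 then show ?case using n0 by (auto simp: u_def dist_commute)
    next
      case (Suc n)
      have "dist ((p ^^ (k * Suc n)) u) c = dist ((p ^^ k) ((p ^^ (k*n)) u)) c" by (simp add: funpow_add)
      also have "\<dots> \<le> 1/2 * dist ((p ^^ (k*n)) u) c" using Suc contr by blast
      finally have 1: "dist ((p ^^ (k * Suc n)) u) c \<le> 1/2 * dist ((p ^^ (k*n)) u) c" .
      have "dist ((p ^^ (k*n)) u) c < \<epsilon>" using Suc by (simp add: dist_commute)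
      with 1 have "dist ((p ^^ (k * Suc n)) u) c < \<epsilon>" using eps by linarith
      with 1 Suc show ?case by (auto simp: dist_commute)
    qed
    have "(\<lambda>n. (1/2)^n * \<epsilon>) \<longlonglongrightarrow> 0" by (intro tendsto_mult_left_zero LIMSEQ_power_zero) auto
    then have "(\<lambda>n. (p ^^ (k * n)) u) \<longlonglongrightarrow> c"
      by (rule metric_tendsto_imp_tendsto) (use it eps in \<open>simp add: eventually_sequentially\<close>)
    then have "(\<lambda>n. (p ^^ (k * (n + n0))) v) \<longlonglongrightarrow> c"
      by (simp add: u_def distrib_left funpow_add)
    then show ?thesis by (rule LIMSEQ_offset)
  qed
  have opA: "open A" unfolding A_def
    using hol by (intro open_UN ballI open_vimage holomorphic_on_imp_continuous_on) auto
  have cA: "c \<in> A"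
  proof -
    have "c \<in> (p ^^ (k * 0)) -` ball c \<epsilon>" using eps by simp
    then show ?thesis unfolding A_def by blast
  qed
  have "U \<subseteq> A"
  proof (rule Fatou_component_subset[OF U opA])
    show "A \<inter> U \<noteq> {}" using sub cA by blast
  next
    fix C assume opC: "open C" "connected C" and C: "C \<inter> A \<noteq> {}"
      and nrm: "\<And>m::nat\<Rightarrow>nat. \<exists>r::nat\<Rightarrow>nat. strict_mono r \<and> (converges_loc_uniformly_on C (\<lambda>i. p ^^ (m (r i))) \<or>
                                diverges_loc_uniformly_on C (\<lambda>i. p ^^ (m (r i))))"
    from nrm[of "\<lambda>i. k * i"] obtain r :: "nat \<Rightarrow> nat"
      where r': "strict_mono r \<and> (converges_loc_uniformly_on C (\<lambda>i. p ^^ (k * r i)) \<or>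
                                diverges_loc_uniformly_on C (\<lambda>i. p ^^ (k * r i)))" ..
    note r = conjunct1[OF r'] conjunct2[OF r']
    have convr: "(\<lambda>i. (p ^^ (k * r i)) v) \<longlonglongrightarrow> c" if "v \<in> A" for v
      using LIMSEQ_subseq_LIMSEQ[OF conv[OF that] r(1)] by (simp add: o_def)
    have "\<not> diverges_loc_uniformly_on C (\<lambda>i. p ^^ (k * r i))"
    proof
      assume div: "diverges_loc_uniformly_on C (\<lambda>i. p ^^ (k * r i))"
      obtain v where v: "v \<in> C" "v \<in> A" using C by blast
      have 1: "\<forall>\<^sub>F i in sequentially. \<forall>x\<in>{v}. norm ((p ^^ (k * r i)) x) > norm c + 1"
        using div[unfolded diverges_loc_uniformly_on_def, rule_format, of "{v}" "norm c + 1"] v(1) by simp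
      have 2: "\<forall>\<^sub>F i in sequentially. norm ((p ^^ (k * r i)) v) < norm c + 1"
        by (rule order_tendstoD(2)[OF tendsto_norm[OF convr[OF v(2)]]]) simp
      from 1 2 have "\<forall>\<^sub>F i in sequentially. False" by eventually_elim auto
      then show False by simp
    qed
    with r(2) obtain h where h: "\<And>K. compact K \<Longrightarrow> K \<subseteq> C \<Longrightarrow> uniform_limit K (\<lambda>i. p ^^ (k * r i)) h sequentially"
      unfolding converges_loc_uniformly_on_def by blast
    have holh: "h holomorphic_on C"
    proof (rule holomorphic_uniform_sequence[OF opC(1)])
      show "(p ^^ (k * r n)) holomorphic_on C" for n using hol holomorphic_on_subset by blast
      fix x assume "x \<in> C"
      then obtain d where "d > 0" "cball x d \<subseteq> C" using opC(1) open_contains_cball by blast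
      then show "\<exists>d>0. cball x d \<subseteq> C \<and> uniform_limit (cball x d) (\<lambda>i. p ^^ (k * r i)) h sequentially"
        using h by auto
    qed
    have pt: "(\<lambda>i. (p ^^ (k * r i)) v) \<longlonglongrightarrow> h v" if "v \<in> C" for v
      by (rule tendsto_uniform_limitI[OF h[of "{v}"]]) (use that in auto)
    have hc: "h v = c" if "v \<in> C \<inter> A" for v
      using LIMSEQ_unique[OF pt convr] that by blast
    have hcC: "h w = c" if "w \<in> C" for w
      by (rule analytic_continuation_open[of "C \<inter> A" C h "\<lambda>_. c"])
         (use opC opA C holh hc that in auto)
    show "C \<subseteq> A"
    proof
      fix w assume w: "w \<in> C"
      have "(\<lambda>i. (p ^^ (k * r i)) w) \<longlonglongrightarrow> c" using pt[OF w] hcC[OF w] by simp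
      then have "\<forall>\<^sub>F i in sequentially. dist ((p ^^ (k * r i)) w) c < \<epsilon>" using eps by (rule tendstoD)
      then obtain i where "(p ^^ (k * r i)) w \<in> ball c \<epsilon>" by (auto simp: eventually_sequentially dist_commute)
      then show "w \<in> A" unfolding A_def by blast
    qed
  qed
  with z obtain n where "(p ^^ (k * n)) z \<in> ball c \<epsilon>" unfolding A_def by blast
  then show ?thesis by blast
qed

text \<open>The trap \<open>W\<close> lies in the Fatou set, and so does
  \<open>{0} \<times> U\<close>: by \<open>absorb\<close> each of its points has a neighborhood with
  a forward image in \<open>W\<close>, and tameness pulls back. The two sets are connected and meet
  over \<open>0\<close>, so one component contains both.\<close>

lemma bulging_component_of_trap:
  assumes \<Delta>: "open \<Delta>" "0 \<in> \<Delta>"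
    and cont: "continuous_on (\<Delta> \<times> UNIV) (skew lam f)" and inv: "skew lam f ` (\<Delta> \<times> UNIV) \<subseteq> \<Delta> \<times> UNIV"
    and W: "open W" "connected W" "W \<subseteq> \<Delta> \<times> UNIV" "uniformly_tame_on (skew lam f) W"
    and S: "{z. (0, z) \<in> W} \<noteq> {}" "connected {z. (0, z) \<in> W}"
    and absorb: "\<And>U z. U \<in> Fatou_components UNIV (f 0) \<Longrightarrow> {z. (0, z) \<in> W} \<subseteq> U \<Longrightarrow> z \<in> U \<Longrightarrow>
           \<exists>n. (0, (f 0 ^^ n) z) \<in> W"
  shows "\<exists>\<Omega>. bulging \<Delta> lam f \<Omega> \<and> W \<subseteq> \<Omega>"
proof -
  let ?S = "{z. (0, z) \<in> W}" and ?F = "Fatou_set (\<Delta> \<times> UNIV) (skew lam f)"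
  have "?S = Pair 0 -` W" by auto
  moreover have "open (Pair 0 -` W)" using W(1) by (intro open_vimage continuous_intros)
  ultimately have opS: "open ?S" by metis
  have "?S \<subseteq> Fatou_set UNIV (f 0)"
    by (rule subset_Fatou_set[where n = 0 and W = ?S]) (use opS S uniformly_tame_slice[OF W(4)] in auto)
  then obtain U where U: "U \<in> Fatou_components UNIV (f 0)" "?S \<subseteq> U"
    using exists_component_superset[of ?S "Fatou_set UNIV (f 0)"] S unfolding Fatou_components_def by blast
  have WF: "W \<subseteq> ?F"
    by (rule subset_Fatou_set[where n = 0 and W = W]) (use W in auto)
  have "(0, z) \<in> ?F" if z: "z \<in> U" for z
  proof -
    obtain n where n: "(0, (f 0 ^^ n) z) \<in> W" using absorb[OF U z] by blast
    define V where "V = (\<Delta> \<times> UNIV) \<inter> (skew lam f ^^ n) -` W"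
    have "open V" unfolding V_def
      using continuous_on_funpow(1)[OF cont inv] \<Delta> W(1)
      by (intro continuous_open_preimage open_Times) auto
    moreover have "(0, z) \<in> V" using n \<Delta> by (auto simp: V_def skew_funpow_0)
    ultimately obtain e where e: "e > 0" "ball (0, z) e \<subseteq> V" using open_contains_ball by blast
    have "ball (0, z) e \<subseteq> ?F"
      by (rule subset_Fatou_set[where n = n and W = W]) (use e W in \<open>auto simp: V_def\<close>)
    with e show ?thesis by auto
  qed
  then have UF: "{0} \<times> U \<subseteq> ?F" by auto
  have "connected U" using U unfolding Fatou_components_def by (auto dest: in_components_connected)
  then have "connected (W \<union> {0} \<times> U)"
    using W S U(2) by (intro connected_Un connected_Times) auto
  then obtain \<Omega> where "\<Omega> \<in> components ?F" "W \<union> {0} \<times> U \<subseteq> \<Omega>"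
    using exists_component_superset[of "W \<union> {0} \<times> U" ?F] WF UF S by blast
  with U show ?thesis unfolding bulging_def Fatou_components_def by blast
qed

section \<open>The fibered family\<close>

locale polynomial_family =
  fixes \<delta> R :: real and d :: nat
    and a :: "nat \<Rightarrow> complex \<Rightarrow> complex" and f :: "complex \<Rightarrow> complex \<Rightarrow> complex"
  assumes \<delta>: "\<delta> > 0" and d: "d \<ge> 2"
    and hol: "\<And>i. i \<le> d \<Longrightarrow> a i holomorphic_on ball 0 \<delta>" and lead0: "a d 0 \<noteq> 0"
    and f_def: "\<And>t z. t \<in> ball 0 \<delta> \<Longrightarrow> f t z = (\<Sum>i\<le>d. a i t * z ^ i)"
    and R: "R > 0" and escape: "\<And>t z. t \<in> ball 0 \<delta> \<Longrightarrow> norm z > R \<Longrightarrow> norm (f t z) \<ge> 2 * norm z"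
begin

definition Q :: "complex \<Rightarrow> complex poly" where "Q t = (\<Sum>i\<le>d. monom (a i t) i)"

abbreviation X :: "(complex \<times> complex) set" where "X \<equiv> ball 0 \<delta> \<times> UNIV"

lemma poly_Q: "poly (Q t) z = (\<Sum>i\<le>d. a i t * z ^ i)"
  by (simp add: Q_def poly_sum poly_monom)

lemma poly_pderiv_Q: "poly (pderiv (Q t)) z = (\<Sum>i\<le>d. of_nat i * a i t * z ^ (i - 1))"
proof -
  have "poly (pderiv (Q t)) z = (\<Sum>i\<le>d. poly (pderiv (monom (a i t) i)) z)"
    by (simp add: Q_def higher_pderiv_sum[of 1, simplified] poly_sum)
  then show ?thesis by (simp add: pderiv_monom poly_monom)
qed

lemma f_eq_Q: "t \<in> ball 0 \<delta> \<Longrightarrow> f t = poly (Q t)"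
  by (auto simp: f_def poly_Q)

lemma f0_eq_Q: "f 0 = poly (Q 0)"
  using \<delta> by (intro f_eq_Q) auto

lemma coeff_Q: "coeff (Q t) i = (if i \<le> d then a i t else 0)"
  by (simp add: Q_def coeff_sum)

lemma degree_Q: "a d t \<noteq> 0 \<Longrightarrow> degree (Q t) = d"
  by (intro antisym le_degree degree_le) (auto simp: coeff_Q)

lemma coefficient_lipschitz_at_0:
  "\<exists>L>0. \<forall>i\<le>d. \<forall>t\<in>cball 0 (\<delta>/2). norm (a i t - a i 0) \<le> L * norm t"
proof -
  have sub: "cball 0 (\<delta>/2) \<subseteq> ball (0::complex) \<delta>" using \<delta> by auto
  have "\<exists>L>0. \<forall>t\<in>cball 0 (\<delta>/2). norm (a i t - a i 0) \<le> L * norm t" if i: "i \<le> d" for i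
  proof -
    have "deriv (a i) holomorphic_on ball 0 \<delta>" using hol[OF i] by (rule holomorphic_deriv) simp
    then have "continuous_on (cball 0 (\<delta>/2)) (deriv (a i))"
      using sub continuous_on_subset holomorphic_on_imp_continuous_on by blast
    then have "bounded (deriv (a i) ` cball 0 (\<delta>/2))"
      by (intro compact_imp_bounded compact_continuous_image) auto
    then obtain L where L: "L > 0" "\<And>t. t \<in> cball 0 (\<delta>/2) \<Longrightarrow> norm (deriv (a i) t) \<le> L"
      unfolding bounded_pos by blast
    have "norm (a i t - a i 0) \<le> L * norm (t - 0)" if "t \<in> cball 0 (\<delta>/2)" for t
    proof (rule field_differentiable_bound[of "cball 0 (\<delta>/2)" "a i" "deriv (a i)"])
      fix s :: complex assume "s \<in> cball 0 (\<delta>/2)"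
      then have "s \<in> ball 0 \<delta>" using sub by blast
      then show "(a i has_field_derivative deriv (a i) s) (at s within cball 0 (\<delta>/2))"
        using holomorphic_derivI[OF hol[OF i], of s] has_field_derivative_at_within by blast
    qed (use L that \<delta> in auto)
    with L(1) show ?thesis by auto
  qed
  then have "\<forall>i\<in>{..d}. \<exists>L>0. \<forall>t\<in>cball 0 (\<delta>/2). norm (a i t - a i 0) \<le> L * norm t" by blast
  from bchoice[OF this] obtain L where L': "\<forall>i\<in>{..d}. L i > 0 \<and> (\<forall>t\<in>cball 0 (\<delta>/2). norm (a i t - a i 0) \<le> L i * norm t)" ..
  then have L: "L i > 0" "t \<in> cball 0 (\<delta>/2) \<Longrightarrow> norm (a i t - a i 0) \<le> L i * norm t" if "i \<le> d" for i t
    using that by auto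
  have "norm (a i t - a i 0) \<le> (\<Sum>i\<le>d. L i) * norm t" if "i \<le> d" "t \<in> cball 0 (\<delta>/2)" for i t
  proof -
    have "L i \<le> (\<Sum>i\<le>d. L i)" using L(1) that by (intro member_le_sum) (auto intro: less_imp_le)
    then have "L i * norm t \<le> (\<Sum>i\<le>d. L i) * norm t" by (intro mult_right_mono) auto
    with L(2)[OF that] show ?thesis by linarith
  qed
  moreover have "(\<Sum>i\<le>d. L i) > 0" using L(1) by (intro sum_pos) auto
  ultimately show ?thesis by blast
qed

text \<open>One constant for the fiber map and its vertical derivative, so that the same shadowing
  error controls orbit and derivative.\<close>

lemma lipschitz_constant:
  "\<exists>K\<ge>1. \<forall>t z y. norm t \<le> \<delta>/2 \<longrightarrow> norm z \<le> B \<longrightarrow> norm y \<le> B \<longrightarrow>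
     dist (f t z) (f 0 y) \<le> K * (norm t + dist z y) \<and>
     dist (poly (pderiv (Q t)) z) (poly (pderiv (Q 0)) y) \<le> K * (norm t + dist z y)"
proof -
  obtain L where L: "L > 0" "\<And>i t. i \<le> d \<Longrightarrow> norm t \<le> \<delta>/2 \<Longrightarrow> norm (a i t - a i 0) \<le> L * norm t"
    using coefficient_lipschitz_at_0 by auto
  obtain M1 where M1: "M1 > 0" "\<And>x y. x \<in> cball 0 B \<Longrightarrow> y \<in> cball 0 B \<Longrightarrow> dist (poly (Q 0) x) (poly (Q 0) y) \<le> M1 * dist x y"
    using poly_lipschitz_on_cball[of 0 B "Q 0"] by blast
  obtain M2 where M2: "M2 > 0" "\<And>x y. x \<in> cball 0 B \<Longrightarrow> y \<in> cball 0 B \<Longrightarrow> dist (poly (pderiv (Q 0)) x) (poly (pderiv (Q 0)) y) \<le> M2 * dist x y"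
    using poly_lipschitz_on_cball[of 0 B "pderiv (Q 0)"] by blast
  define S1 where "S1 = (\<Sum>i\<le>d. L * B ^ i)"
  define S2 where "S2 = (\<Sum>i\<le>d. of_nat i * L * B ^ (i - 1))"
  define K where "K = max 1 (max (max M1 S1) (max M2 S2))"
  have K: "1 \<le> K" "M1 \<le> K" "S1 \<le> K" "M2 \<le> K" "S2 \<le> K" by (auto simp: K_def)
  have "dist (f t z) (f 0 y) \<le> K * (norm t + dist z y) \<and>
     dist (poly (pderiv (Q t)) z) (poly (pderiv (Q 0)) y) \<le> K * (norm t + dist z y)"
    if t: "norm t \<le> \<delta>/2" and z: "norm z \<le> B" and y: "norm y \<le> B" for t z y
  proof
    have pw: "norm z ^ n \<le> B ^ n" for n using z by (intro power_mono) auto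
    have B: "0 \<le> B" using z norm_ge_zero order_trans by blast
    have tb: "t \<in> ball 0 \<delta>" using t \<delta> by auto
    have "dist (poly (Q t) z) (poly (Q 0) z) = norm (\<Sum>i\<le>d. (a i t - a i 0) * z ^ i)"
      by (simp add: poly_Q dist_norm sum_subtractf left_diff_distrib)
    also have "\<dots> \<le> (\<Sum>i\<le>d. (L * norm t) * B ^ i)"
      using L t pw B by (intro sum_norm_le) (auto simp: norm_mult norm_power intro!: mult_mono)
    also have "\<dots> = S1 * norm t" by (simp add: S1_def sum_distrib_left sum_distrib_right mult_ac)
    also have "\<dots> \<le> K * norm t" using K by (intro mult_right_mono) auto
    finally have 1: "dist (poly (Q t) z) (poly (Q 0) z) \<le> K * norm t" .
    have "dist (poly (Q 0) z) (poly (Q 0) y) \<le> M1 * dist z y" using M1 z y by auto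
    also have "\<dots> \<le> K * dist z y" using K by (intro mult_right_mono) auto
    finally have 2: "dist (poly (Q 0) z) (poly (Q 0) y) \<le> K * dist z y" .
    show "dist (f t z) (f 0 y) \<le> K * (norm t + dist z y)"
      unfolding f_eq_Q[OF tb] f0_eq_Q
      using 1 2 dist_triangle[of "poly (Q t) z" "poly (Q 0) y" "poly (Q 0) z"] by (simp add: distrib_left)
    have "dist (poly (pderiv (Q t)) z) (poly (pderiv (Q 0)) z)
        = norm (\<Sum>i\<le>d. of_nat i * (a i t - a i 0) * z ^ (i-1))"
      by (simp add: poly_pderiv_Q dist_norm sum_subtractf[symmetric] algebra_simps)
    also have "\<dots> \<le> (\<Sum>i\<le>d. of_nat i * (L * norm t) * B ^ (i-1))"
      using L t pw B by (intro sum_norm_le) (auto simp: norm_mult norm_power intro!: mult_mono)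
    also have "\<dots> = S2 * norm t" by (simp add: S2_def sum_distrib_left sum_distrib_right mult_ac)
    also have "\<dots> \<le> K * norm t" using K by (intro mult_right_mono) auto
    finally have 3: "dist (poly (pderiv (Q t)) z) (poly (pderiv (Q 0)) z) \<le> K * norm t" .
    have "dist (poly (pderiv (Q 0)) z) (poly (pderiv (Q 0)) y) \<le> M2 * dist z y" using M2 z y by auto
    also have "\<dots> \<le> K * dist z y" using K by (intro mult_right_mono) auto
    finally have 4: "dist (poly (pderiv (Q 0)) z) (poly (pderiv (Q 0)) y) \<le> K * dist z y" .
    show "dist (poly (pderiv (Q t)) z) (poly (pderiv (Q 0)) y) \<le> K * (norm t + dist z y)"
      using 3 4 dist_triangle[of "poly (pderiv (Q t)) z" "poly (pderiv (Q 0)) y" "poly (pderiv (Q 0)) z"]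
      by (simp add: distrib_left)
  qed
  with K(1) show ?thesis by (intro exI[of _ K]) simp
qed

lemma skew_eq: "skew lam f x = (lam * fst x, f (fst x) (snd x))"
  by (simp add: skew_def case_prod_beta)

lemma skew_invariant: "norm lam < 1 \<Longrightarrow> skew lam f ` X \<subseteq> X"
proof -
  assume lam: "norm lam < 1"
  have "norm (lam * t) < \<delta>" if "norm t < \<delta>" for t
  proof -
    have "norm (lam * t) \<le> 1 * norm t" unfolding norm_mult using lam by (intro mult_right_mono) auto
    with that show ?thesis by simp
  qed
  note lt = this
  show ?thesis
  proof (intro image_subsetI)
    fix x assume "x \<in> X"
    then have "norm (lam * fst x) < \<delta>" by (intro lt) (simp add: mem_Times_iff)
    then show "skew lam f x \<in> X" by (simp add: skew_eq mem_Times_iff)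
  qed
qed

lemma continuous_on_skew: "continuous_on X (skew lam f)"
proof -
  have "continuous_on X (\<lambda>x. a i (fst x))" if "i \<le> d" for i
  proof (rule continuous_on_compose2[of "ball 0 \<delta>" "a i"])
    show "continuous_on (ball 0 \<delta>) (a i)" using hol[OF that] by (rule holomorphic_on_imp_continuous_on)
    show "continuous_on X fst" by (intro continuous_on_fst continuous_on_id)
    show "fst ` X \<subseteq> ball 0 \<delta>" by (simp add: image_subset_iff mem_Times_iff)
  qed
  then have "continuous_on X (\<lambda>x. (lam * fst x, \<Sum>i\<le>d. a i (fst x) * snd x ^ i))"
    by (intro continuous_on_Pair continuous_on_sum continuous_on_mult continuous_on_power
        continuous_on_fst continuous_on_snd continuous_on_id continuous_on_const) simp
  then show ?thesis
    by (rule continuous_on_eq) (simp add: skew_eq f_def mem_Times_iff)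
qed

lemma continuous_on_f0: "continuous_on UNIV (f 0)"
  unfolding f0_eq_Q by (intro continuous_intros)

lemma holomorphic_on_f0_funpow: "(f 0 ^^ n) holomorphic_on UNIV"
proof (induction n)
  case (Suc n)
  have "(\<lambda>z. \<Sum>i\<le>d. a i 0 * (f 0 ^^ n) z ^ i) holomorphic_on UNIV"
    using Suc by (intro holomorphic_intros)
  moreover have "f 0 ^^ Suc n = (\<lambda>z. \<Sum>i\<le>d. a i 0 * (f 0 ^^ n) z ^ i)"
    using \<delta> by (auto simp: f_def)
  ultimately show ?case by simp
qed (simp add: id_def)

section \<open>Bulging components over the two kinds of basins\<close>

lemma connected_exterior: "connected {z::complex. norm z > r}"
proof -
  have "{z::complex. norm z > r} = - cball 0 r" by auto
  then show ?thesis using connected_complement_bounded_convex[of "cball (0::complex) r"] by simp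
qed

lemma bulging_at_infinity:
  assumes lam: "norm lam < 1"
  shows "\<exists>\<Omega>. bulging (ball 0 \<delta>) lam f \<Omega> \<and> ball 0 \<delta> \<times> {z. norm z > R} \<subseteq> \<Omega>"
proof (rule bulging_component_of_trap)
  let ?W = "ball (0::complex) \<delta> \<times> {z::complex. norm z > R}"
  have S: "{z. (0, z) \<in> ?W} = {z. norm z > R}" using \<delta> by auto
  have opR: "open {z::complex. norm z > R}" by (intro open_Collect_less continuous_intros)
  show "open ?W" using opR by (intro open_Times) auto
  show "connected ?W" using connected_exterior by (intro connected_Times) auto
  show "connected {z. (0, z) \<in> ?W}" unfolding S by (rule connected_exterior)
  have inS: "complex_of_real (R + 1) \<in> {z. norm z > R}" using R by simp
  then show "{z. (0, z) \<in> ?W} \<noteq> {}" unfolding S by blast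
  show "\<exists>n. (0, (f 0 ^^ n) z) \<in> ?W"
    if U: "U \<in> Fatou_components UNIV (f 0)" "{z. (0, z) \<in> ?W} \<subseteq> U" "z \<in> U" for U z
  proof -
    have "{z. norm z > R} \<inter> U \<noteq> {}" using U(2) inS unfolding S by blast
    then have "\<exists>n. norm ((f 0 ^^ n) z) > R"
      using U R continuous_on_f0 escape[of 0] \<delta> by (intro Fatou_component_in_basin_of_infinity) auto
    with \<delta> show ?thesis by auto
  qed
  have grow: "(skew lam f ^^ n) x \<in> X \<and> norm (snd ((skew lam f ^^ n) x)) \<ge> 2 ^ n * R
      \<and> norm (snd ((skew lam f ^^ n) x)) > R" if x: "x \<in> ?W" for n x
  proof (induction n)
    case (Suc n)
    define y where "y = (skew lam f ^^ n) x"
    have y: "y \<in> X" "norm (snd y) \<ge> 2 ^ n * R" "norm (snd y) > R" using Suc by (auto simp: y_def)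
    have "2 * norm (snd y) \<le> norm (f (fst y) (snd y))" using y by (intro escape) auto
    then have "norm (snd (skew lam f y)) \<ge> 2 ^ Suc n * R \<and> norm (snd (skew lam f y)) > R"
      using y R by (auto simp: skew_def split: prod.split)
    moreover have "skew lam f y \<in> X" using skew_invariant[OF lam] y(1) by blast
    ultimately show ?case by (simp add: y_def)
  qed (use x in auto)
  show "uniformly_tame_on (skew lam f) ?W"
    unfolding uniformly_tame_on_def
  proof (intro allI impI exI[of _ "\<lambda>i. i"] conjI disjI2)
    fix m :: "nat \<Rightarrow> nat" and B :: real assume m: "strict_mono m"
    obtain j where j: "B / R < 2 ^ j" using real_arch_pow[of 2 "B/R"] by auto
    show "\<forall>\<^sub>F i in sequentially. \<forall>x\<in>?W. norm ((skew lam f ^^ (m i)) x) > B"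
      unfolding eventually_sequentially
    proof (intro exI allI impI ballI)
      fix i x assume i: "j \<le> i" and x: "x \<in> ?W"
      have "j \<le> m i" using strict_mono_imp_increasing[OF m, of i] i by simp
      have "B < 2 ^ j * R" using j R by (simp add: divide_simps)
      also have "\<dots> \<le> 2 ^ (m i) * R" using \<open>j \<le> m i\<close> R by (intro mult_right_mono power_increasing) auto
      also have "\<dots> \<le> norm (snd ((skew lam f ^^ (m i)) x))" using grow[OF x] by blast
      also have "\<dots> \<le> norm ((skew lam f ^^ (m i)) x)" by (metis norm_snd_le prod.collapse)
      finally show "B < norm ((skew lam f ^^ (m i)) x)" .
    qed
  qed (simp add: strict_mono_def)
qed (use \<delta> skew_invariant[OF lam] continuous_on_skew in auto)

text \<open>The bound \<open>B'\<close> on both orbits is part of the induction because the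
  Lipschitz constant for the next step exists only on bounded sets.\<close>

lemma fiber_dependence:
  assumes lam: "norm lam < 1"
  shows "\<exists>C\<ge>0. \<exists>B'. \<forall>t z. norm t \<le> \<delta>/2 \<longrightarrow> norm z \<le> B \<longrightarrow>
     dist (snd ((skew lam f ^^ k) (t, z))) ((f 0 ^^ k) z) \<le> C * norm t \<and>
     norm (snd ((skew lam f ^^ k) (t, z))) \<le> B' \<and> norm ((f 0 ^^ k) z) \<le> B'"
proof (induction k)
  case 0
  show ?case by (intro exI[of _ 0] conjI exI[of _ B]) auto
next
  case (Suc k)
  then obtain C B' where C: "C \<ge> 0" and *: "\<And>t z. norm t \<le> \<delta>/2 \<Longrightarrow> norm z \<le> B \<Longrightarrow>
     dist (snd ((skew lam f ^^ k) (t, z))) ((f 0 ^^ k) z) \<le> C * norm t \<and>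
     norm (snd ((skew lam f ^^ k) (t, z))) \<le> B' \<and> norm ((f 0 ^^ k) z) \<le> B'" by blast
  obtain K where K: "K \<ge> 1" and lip: "\<And>t z y. norm t \<le> \<delta>/2 \<Longrightarrow> norm z \<le> B' \<Longrightarrow> norm y \<le> B' \<Longrightarrow>
     dist (f t z) (f 0 y) \<le> K * (norm t + dist z y)"
    using lipschitz_constant[of B'] by blast
  define N where "N = norm (f 0 0) + K * (\<delta>/2 + \<bar>B'\<bar>)"
  have "dist (snd ((skew lam f ^^ Suc k) (t, z))) ((f 0 ^^ Suc k) z) \<le> (K * (1 + C)) * norm t \<and>
     norm (snd ((skew lam f ^^ Suc k) (t, z))) \<le> N \<and> norm ((f 0 ^^ Suc k) z) \<le> N"
    if t: "norm t \<le> \<delta>/2" and z: "norm z \<le> B" for t z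
  proof -
    define w where "w = snd ((skew lam f ^^ k) (t, z))"
    define y where "y = (f 0 ^^ k) z"
    define s where "s = lam ^ k * t"
    have wy: "dist w y \<le> C * norm t" "norm w \<le> B'" "norm y \<le> B'"
      using *[OF t z] by (auto simp: w_def y_def)
    have s1: "norm s \<le> norm t"
    proof -
      have "norm s \<le> 1 * norm t" unfolding s_def norm_mult norm_power
        using lam by (intro mult_right_mono power_le_one) auto
      then show ?thesis by simp
    qed
    then have s: "norm s \<le> \<delta>/2" using t by simp
    have "(skew lam f ^^ k) (t, z) = (s, w)"
      using fst_skew_funpow[of k lam f "(t, z)"] by (simp add: s_def w_def prod_eq_iff)
    then have e1: "snd ((skew lam f ^^ Suc k) (t, z)) = f s w" by (simp add: skew_def)
    have e2: "(f 0 ^^ Suc k) z = f 0 y" by (simp add: y_def)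
    have "dist (f s w) (f 0 y) \<le> K * (norm s + dist w y)" using lip s wy by blast
    also have "\<dots> \<le> K * (norm t + C * norm t)" using K s1 wy by (intro mult_left_mono) auto
    finally have 1: "dist (f s w) (f 0 y) \<le> (K * (1 + C)) * norm t" by (simp add: algebra_simps)
    have B': "0 \<le> B'" using wy(2) norm_ge_zero order_trans by blast
    have bd: "norm (f u v) \<le> N" if "norm u \<le> \<delta>/2" "norm v \<le> B'" for u v
    proof -
      have "norm (f u v) \<le> norm (f 0 0) + dist (f u v) (f 0 0)"
        by (metis dist_norm norm_triangle_sub)
      also have "dist (f u v) (f 0 0) \<le> K * (norm u + dist v 0)" using that B' by (intro lip) auto
      also have "\<dots> \<le> K * (\<delta>/2 + \<bar>B'\<bar>)" using K that by (intro mult_left_mono) auto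
      finally show ?thesis by (simp add: N_def)
    qed
    show ?thesis unfolding e1 e2 using 1 bd[OF s wy(2)] bd[of 0 y] wy(3) \<delta> by simp
  qed
  then show ?case using K C by (intro exI[of _ "K * (1 + C)"] conjI exI[of _ N]) auto
qed

text \<open>By the chain rule the multiplier of the cycle contains the factor
  \<open>poly (pderiv (Q 0)) c\<close>, so it is zero and any contraction factor is available near
  \<open>c\<close>.\<close>

lemma superattracting_contraction:
  assumes crit: "poly (pderiv (Q 0)) c = 0" and k: "k > 0" and per: "(f 0 ^^ k) c = c"
  shows "\<exists>\<epsilon>>0. \<forall>z\<in>ball c \<epsilon>. dist ((f 0 ^^ k) z) c \<le> 1/2 * dist z c"
proof -
  obtain k' where k': "k = Suc k'" using k by (cases k) auto
  have "((f 0 ^^ k') has_field_derivative deriv (f 0 ^^ k') (f 0 c)) (at (f 0 c))"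
    by (rule holomorphic_derivI[OF holomorphic_on_f0_funpow]) auto
  moreover have "(f 0 has_field_derivative 0) (at c)"
    using poly_DERIV[of "Q 0" c] crit by (simp add: f0_eq_Q)
  ultimately have "((f 0 ^^ k') \<circ> f 0 has_field_derivative deriv (f 0 ^^ k') (f 0 c) * 0) (at c)"
    by (rule DERIV_chain)
  then have "((f 0 ^^ k) has_field_derivative 0) (at c)" by (simp add: k' funpow_Suc_right del: funpow.simps)
  then have "((f 0 ^^ k) has_derivative (\<lambda>_. 0)) (at c)"
    by (simp add: has_field_derivative_def lambda_zero)
  then have "\<forall>e>0. \<exists>\<epsilon>>0. \<forall>z. norm (z - c) < \<epsilon> \<longrightarrow> norm ((f 0 ^^ k) z - (f 0 ^^ k) c - 0) \<le> e * norm (z - c)"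
    unfolding has_derivative_at_alt by blast
  from this[rule_format, of "1/2"] show ?thesis
    using per by (auto simp: dist_norm norm_minus_commute)
qed

text \<open>Over one period the fiber coordinate shrinks by \<open>norm lam ^ k\<close> and disturbs
  the contraction toward \<open>c\<close> by at most \<open>C * norm t\<close>. For
  \<open>C * \<eta> \<le> \<epsilon>/2\<close> the bidisk is therefore mapped into itself. The
  radius \<epsilon> is prescribed; only \<eta> adapts to \<open>lam\<close>.\<close>

lemma bulging_at_superattracting:
  assumes crit: "poly (pderiv (Q 0)) c = 0" and k: "k > 0" and per: "(f 0 ^^ k) c = c"
    and eps: "\<epsilon> > 0" and contr: "\<And>z. z \<in> ball c \<epsilon> \<Longrightarrow> dist ((f 0 ^^ k) z) c \<le> 1/2 * dist z c"
    and lam: "norm lam < 1"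
  shows "\<exists>\<eta>>0. \<exists>\<Omega>. bulging (ball 0 \<delta>) lam f \<Omega> \<and> ball 0 \<eta> \<times> ball c \<epsilon> \<subseteq> \<Omega>"
proof -
  obtain C where C: "C \<ge> 0" and dep: "\<And>t z. norm t \<le> \<delta>/2 \<Longrightarrow> norm z \<le> norm c + \<epsilon> \<Longrightarrow>
     dist (snd ((skew lam f ^^ k) (t, z))) ((f 0 ^^ k) z) \<le> C * norm t"
    using fiber_dependence[OF lam, of "norm c + \<epsilon>" k] by blast
  define \<eta> where "\<eta> = min (\<delta>/2) (\<epsilon> / (2 * (C + 1)))"
  have \<eta>: "\<eta> > 0" "\<eta> \<le> \<delta>/2" using \<delta> eps C unfolding \<eta>_def by (simp, intro min.cobounded1)
  have C\<eta>: "C * \<eta> \<le> \<epsilon>/2"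
  proof -
    have "C * \<eta> \<le> (C + 1) * (\<epsilon> / (2 * (C + 1)))"
      using C \<eta> by (intro mult_mono) (auto simp: \<eta>_def)
    also have "\<dots> = \<epsilon>/2" using C by (simp add: field_simps)
    finally show ?thesis .
  qed
  define W where "W = ball (0::complex) \<eta> \<times> ball c \<epsilon>"
  define P where "P = skew lam f"
  define \<sigma> where "\<sigma> = max (1/2) (norm lam ^ k)"
  have \<sigma>: "1/2 \<le> \<sigma>" "norm lam ^ k \<le> \<sigma>" "\<sigma> < 1" "0 < \<sigma>"
    using lam k by (auto simp: \<sigma>_def power_less_one_iff less_max_iff_disj)
  have P1: "dist (snd ((P ^^ k) x)) c \<le> C * norm (fst x) + 1/2 * dist (snd x) c" if "x \<in> W" for x
  proof -
    have x: "norm (fst x) < \<eta>" "snd x \<in> ball c \<epsilon>" using that by (auto simp: W_def)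
    have "norm (snd x) \<le> norm c + \<epsilon>"
      using x(2) norm_triangle_sub[of "snd x" c] by (auto simp: dist_norm norm_minus_commute)
    then have "dist (snd ((P ^^ k) x)) ((f 0 ^^ k) (snd x)) \<le> C * norm (fst x)"
      using dep[of "fst x" "snd x"] x \<eta> by (auto simp: P_def)
    moreover have "dist ((f 0 ^^ k) (snd x)) c \<le> 1/2 * dist (snd x) c" using contr x by blast
    ultimately show ?thesis using dist_triangle[of "snd ((P ^^ k) x)" c "(f 0 ^^ k) (snd x)"] by linarith
  qed
  \<comment> \<open>The contraction and the disturbance are both bounded with the single rate
    \<sigma>, whence the factor linear in \<open>n\<close>. The coefficient
    \<open>2 * C * \<eta>\<close> arises because a disturbance \<open>C * \<eta>\<close> is absorbed
    after factoring out \<open>1/2\<close>.\<close>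
  have it: "(P ^^ (k * n)) x \<in> W \<and> norm (fst ((P ^^ (k * n)) x)) \<le> \<sigma> ^ n * \<eta> \<and>
       dist (snd ((P ^^ (k * n)) x)) c \<le> (\<epsilon> + n * (2 * C * \<eta>)) * \<sigma> ^ n" if x: "x \<in> W" for n x
  proof (induction n)
    case 0
    then show ?case using x by (auto simp: W_def dist_commute)
  next
    case (Suc n)
    define y where "y = (P ^^ (k * n)) x"
    have y: "y \<in> W" "norm (fst y) \<le> \<sigma> ^ n * \<eta>" "dist (snd y) c \<le> (\<epsilon> + n * (2 * C * \<eta>)) * \<sigma> ^ n"
      using Suc by (auto simp: y_def)
    have e: "(P ^^ (k * Suc n)) x = (P ^^ k) y" by (simp add: y_def funpow_add)
    have fy: "fst ((P ^^ k) y) = lam ^ k * fst y" by (simp add: P_def fst_skew_funpow)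
    have 1: "norm (fst ((P ^^ k) y)) \<le> \<sigma> * norm (fst y)"
      unfolding fy norm_mult norm_power using \<sigma> by (intro mult_right_mono) auto
    also have "\<dots> \<le> \<sigma> * (\<sigma> ^ n * \<eta>)" using y \<sigma> by (intro mult_left_mono) auto
    finally have 2: "norm (fst ((P ^^ k) y)) \<le> \<sigma> ^ Suc n * \<eta>" by simp
    have "\<sigma> * norm (fst y) \<le> 1 * norm (fst y)" using \<sigma> by (intro mult_right_mono) auto
    then have 3: "norm (fst ((P ^^ k) y)) < \<eta>" using 1 y(1) by (auto simp: W_def)
    note d1 = P1[OF y(1)]
    have "C * norm (fst y) \<le> C * \<eta>" using y(1) C by (intro mult_left_mono) (auto simp: W_def)
    then have 4: "dist (snd ((P ^^ k) y)) c < \<epsilon>" using d1 C\<eta> y(1) by (auto simp: W_def dist_commute)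
    have "C * norm (fst y) \<le> C * (\<sigma> ^ n * \<eta>)" using y C by (intro mult_left_mono) auto
    then have "dist (snd ((P ^^ k) y)) c \<le> C * (\<sigma> ^ n * \<eta>) + 1/2 * ((\<epsilon> + n * (2 * C * \<eta>)) * \<sigma> ^ n)"
      using d1 y(3) by linarith
    also have "\<dots> = (\<epsilon> + Suc n * (2 * C * \<eta>)) * (1/2 * \<sigma> ^ n)"
      by (simp add: algebra_simps)
    also have "\<dots> \<le> (\<epsilon> + Suc n * (2 * C * \<eta>)) * (\<sigma> * \<sigma> ^ n)"
      using \<sigma> eps C \<eta> by (intro mult_left_mono mult_right_mono add_nonneg_nonneg mult_nonneg_nonneg) auto
    finally have 5: "dist (snd ((P ^^ k) y)) c \<le> (\<epsilon> + Suc n * (2 * C * \<eta>)) * \<sigma> ^ Suc n" by simp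
    have "(P ^^ k) y \<in> W" using 3 4 by (auto simp: W_def mem_Times_iff dist_commute)
    with 2 5 show ?case unfolding e by blast
  qed
  define s where "s n = \<sigma> ^ n * \<eta> + (\<epsilon> + n * (2 * C * \<eta>)) * \<sigma> ^ n" for n
  have s_lim: "s \<longlonglongrightarrow> 0"
  proof -
    have "(\<lambda>n. \<sigma> ^ n) \<longlonglongrightarrow> 0" using \<sigma> by (intro LIMSEQ_power_zero) auto
    moreover have "(\<lambda>n. real n * \<sigma> ^ n) \<longlonglongrightarrow> 0" using powser_times_n_limit_0[of \<sigma>] \<sigma> by simp
    ultimately have "(\<lambda>n. (\<eta> + \<epsilon>) * \<sigma> ^ n + (2 * C * \<eta>) * (real n * \<sigma> ^ n)) \<longlonglongrightarrow> (\<eta> + \<epsilon>) * 0 + (2 * C * \<eta>) * 0"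
      by (intro tendsto_add tendsto_mult tendsto_const)
    moreover have "s = (\<lambda>n. (\<eta> + \<epsilon>) * \<sigma> ^ n + (2 * C * \<eta>) * (real n * \<sigma> ^ n))"
      by (auto simp: s_def algebra_simps)
    ultimately show ?thesis by simp
  qed
  have "\<exists>\<Omega>. bulging (ball 0 \<delta>) lam f \<Omega> \<and> W \<subseteq> \<Omega>"
  proof (rule bulging_component_of_trap)
    have S: "{z. (0, z) \<in> W} = ball c \<epsilon>" using \<eta> by (auto simp: W_def)
    show "open W" "connected W" unfolding W_def by (intro open_Times connected_Times; simp)+
    show "W \<subseteq> X" unfolding W_def using \<eta> \<delta> by auto
    show "{z. (0, z) \<in> W} \<noteq> {}" "connected {z. (0, z) \<in> W}" unfolding S using eps by auto
    have cX: "continuous_on X (P ^^ n)" for n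
      unfolding P_def using continuous_on_funpow(1)[OF continuous_on_skew skew_invariant[OF lam]] .
    have "isCont (P ^^ n) (0, c)" for n
      using cX[of n] \<delta> by (subst (asm) continuous_on_eq_continuous_at) (auto intro: open_Times)
    then show "uniformly_tame_on (skew lam f) W" unfolding P_def[symmetric]
    proof (rule uniformly_tame_of_periodic_attractor[OF k _ s_lim])
      fix n x assume x: "x \<in> W"
      have "dist ((P ^^ (k * n)) x) (0, c) \<le> dist (fst ((P ^^ (k * n)) x)) 0 + dist (snd ((P ^^ (k * n)) x)) c"
        unfolding dist_prod_def by (simp add: sqrt_sum_squares_le_sum)
      then show "dist ((P ^^ (k * n)) x) (0, c) \<le> s n"
        using it[OF x, of n] by (simp add: s_def)
    qed
    show "\<exists>n. (0, (f 0 ^^ n) z) \<in> W"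
      if U: "U \<in> Fatou_components UNIV (f 0)" "{z. (0, z) \<in> W} \<subseteq> U" "z \<in> U" for U z
    proof -
      note holomorphic_on_f0_funpow
      moreover have "c \<in> U" using U(2) eps unfolding S by auto
      ultimately have "\<exists>n. (f 0 ^^ n) z \<in> ball c \<epsilon>"
        using Fatou_component_in_superattracting_basin[OF U(1) _ eps contr _ U(3)] by blast
      with S show ?thesis by blast
    qed
  qed (use \<delta> skew_invariant[OF lam] continuous_on_skew in auto)
  with \<eta> show ?thesis unfolding W_def by blast
qed

end

section \<open>Growth of the logarithmic inradius\<close>

text \<open>An exceptional time multiplies everything accumulated before it by \<open>D\<close>. For
  simplicity every loss, early or late, is charged the full power of \<open>D\<close>;
  \<open>0 \<le> b l\<close> permits this.\<close>

lemma growth_with_exceptions: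
  fixes G b :: "nat \<Rightarrow> real" and D a :: real
  assumes D: "1 \<le> D" and a: "0 \<le> a"
    and all: "\<And>l. l < n \<Longrightarrow> G (Suc l) \<le> D * G l + a"
    and off: "\<And>l. l < n \<Longrightarrow> l \<notin> E \<Longrightarrow> 0 \<le> b l \<and> G (Suc l) \<le> G l + b l"
  shows "G n \<le> D ^ card (E \<inter> {..<n}) * (G 0 + sum b ({..<n} - E) + card (E \<inter> {..<n}) * a)"
  using all off
proof (induction n)
  case 0 then show ?case by simp
next
  case (Suc n)
  let ?c = "card (E \<inter> {..<n})" and ?H = "G 0 + sum b ({..<n} - E)"
  have IH: "G n \<le> D ^ ?c * (?H + ?c * a)" using Suc by simp
  show ?case
  proof (cases "n \<in> E")
    case True
    then have e: "E \<inter> {..<Suc n} = insert n (E \<inter> {..<n})" "{..<Suc n} - E = {..<n} - E"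
      by (auto simp: less_Suc_eq)
    have c: "card (E \<inter> {..<Suc n}) = Suc ?c" unfolding e by simp
    have "G (Suc n) \<le> D * G n + a" using Suc.prems(1) by simp
    also have "\<dots> \<le> D * (D ^ ?c * (?H + ?c * a)) + 1 * a" using IH D by (intro add_mono mult_left_mono) auto
    also have "\<dots> \<le> D * (D ^ ?c * (?H + ?c * a)) + D ^ Suc ?c * a"
      using one_le_power[OF D, of "Suc ?c"] a by (intro add_left_mono mult_right_mono) auto
    also have "\<dots> = D ^ Suc ?c * (?H + Suc ?c * a)" by (simp add: algebra_simps)
    finally show ?thesis unfolding c e(2) .
  next
    case False
    then have e: "E \<inter> {..<Suc n} = E \<inter> {..<n}" "{..<Suc n} - E = insert n ({..<n} - E)"
      by (auto simp: less_Suc_eq)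
    have "G (Suc n) \<le> G n + b n" "0 \<le> b n" using Suc.prems(2)[of n] False by auto
    moreover have "1 * b n \<le> D ^ ?c * b n" using one_le_power[OF D] \<open>0 \<le> b n\<close> by (intro mult_right_mono) auto
    ultimately have "G (Suc n) \<le> D ^ ?c * (?H + ?c * a) + D ^ ?c * b n" using IH by linarith
    also have "\<dots> = D ^ ?c * (G 0 + sum b ({..<Suc n} - E) + ?c * a)" unfolding e(2) by (simp add: algebra_simps)
    finally show ?thesis unfolding e(1) .
  qed
qed

text \<open>Along \<open>N k = (2 * T) ^ k * N0\<close> the factor \<open>T\<close> of a window is
  overcompensated by its length: the quotients \<open>u k = G (N k) / N k\<close> satisfy
  \<open>u (Suc k) \<le> u k / 2 + T * A\<close>. So they eventually stay below
  \<open>2 * T * A + 1\<close>, whatever \<open>G 0\<close> and \<open>N0\<close> are, and one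
  further window reaches the times in between.\<close>

lemma window_growth_imp_linear:
  fixes G :: "nat \<Rightarrow> real" and T N0 :: nat and A :: real
  assumes T: "1 \<le> T" and A: "0 \<le> A" and N0: "1 \<le> N0" and G: "\<And>n. 0 \<le> G n"
    and win: "\<And>N n. N0 \<le> N \<Longrightarrow> N \<le> n \<Longrightarrow> n \<le> 2 * T * N \<Longrightarrow> G n \<le> T * (G N + A * n)"
  shows "\<forall>\<^sub>F n in sequentially. G n \<le> T * (2 * T * A + 1 + A) * n"
proof -
  define h where "h = 2 * T"
  have h: "2 \<le> h" using T by (simp add: h_def)
  define N where "N k = h ^ k * N0" for k
  have N: "N0 \<le> N k" "0 < N k" "N k \<le> N (Suc k)" for k
    using h N0 by (auto simp: N_def)
  define u where "u k = G (N k) / N k" for k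
  have u0: "0 \<le> u k" for k using G by (simp add: u_def)
  have Gu: "G (N k) = u k * N k" for k using N(2)[of k] by (simp add: u_def)
  have ustep: "u (Suc k) \<le> u k / 2 + T * A" for k
  proof -
    have e: "N (Suc k) = 2 * T * N k" by (simp add: N_def h_def)
    have "G (N (Suc k)) \<le> T * (G (N k) + A * N (Suc k))"
      by (rule win) (use N T e in auto)
    also have "\<dots> = (u k / 2 + T * A) * N (Suc k)"
      unfolding Gu e by (simp add: algebra_simps)
    finally show ?thesis using N(2)[of "Suc k"] by (simp add: u_def divide_le_eq)
  qed
  have ubd: "u k \<le> 2 * T * A + u 0 * (1/2)^k" for k
  proof (induction k)
    case 0 then show ?case using A by simp
  next
    case (Suc k)
    have "u (Suc k) \<le> (2 * T * A + u 0 * (1/2)^k) / 2 + T * A" using ustep[of k] divide_right_mono[OF Suc, of 2] by linarith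
    also have "\<dots> = 2 * T * A + u 0 * (1/2)^Suc k" by (simp add: field_simps)
    finally show ?case .
  qed
  have "(\<lambda>k. u 0 * (1/2)^k) \<longlonglongrightarrow> u 0 * 0"
    by (intro tendsto_mult tendsto_const LIMSEQ_power_zero) simp
  then have "\<forall>\<^sub>F k in sequentially. u 0 * (1/2)^k < 1" by (intro order_tendstoD(2)[of _ "u 0 * 0"]) auto
  then obtain k0 where k0: "\<And>k. k0 \<le> k \<Longrightarrow> u 0 * (1/2)^k < 1" by (auto simp: eventually_sequentially)
  have usmall: "u k \<le> 2 * T * A + 1" if "k0 \<le> k" for k using ubd[of k] k0[OF that] by linarith
  have loc: "\<exists>k'\<ge>k0. N k' \<le> n \<and> n \<le> N (Suc k')" if "N k0 \<le> n" "n \<le> N (k0 + k)" for n k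
    using that
  proof (induction k)
    case 0 then show ?case using N(3)[of k0] by (intro exI[of _ k0]) auto
  next
    case (Suc k)
    show ?case
    proof (cases "n \<le> N (k0 + k)")
      case True then show ?thesis using Suc by blast
    next
      case False then show ?thesis using Suc.prems by (intro exI[of _ "k0 + k"]) auto
    qed
  qed
  show ?thesis
    unfolding eventually_sequentially
  proof (intro exI allI impI)
    fix n assume n: "N k0 \<le> n"
    \<comment> \<open>This provides the upper index needed to locate \<open>n\<close> between
      consecutive scales.\<close>
    have "n < 2 ^ n" by (rule less_exp)
    also have "(2::nat) ^ n \<le> h ^ (k0 + n) * N0"
    proof -
      have "(2::nat) ^ n \<le> h ^ n" using h by (intro power_mono) auto
      also have "\<dots> \<le> h ^ (k0 + n)" using h by (intro power_increasing) auto
      also have "\<dots> \<le> h ^ (k0 + n) * N0" using N0 by simp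
      finally show ?thesis .
    qed
    finally have "n \<le> N (k0 + n)" by (simp add: N_def)
    with loc[OF n] obtain k where k: "k0 \<le> k" "N k \<le> n" "n \<le> N (Suc k)" by blast
    have "G n \<le> T * (G (N k) + A * n)"
      using N k by (intro win) (auto simp: N_def h_def)
    also have "G (N k) \<le> (2 * T * A + 1) * n"
      unfolding Gu using usmall[OF k(1)] k(2) u0 A by (intro mult_mono) auto
    also have "T * ((2 * T * A + 1) * n + A * n) = T * (2 * T * A + 1 + A) * n" by (simp add: algebra_simps)
    finally show "G n \<le> T * (2 * T * A + 1 + A) * n" by (simp add: mult_left_mono)
  qed
qed

text \<open>For bounded \<open>U\<close> the supremum is over a bounded set, and since balls are
  open it is itself an admissible radius.\<close>

lemma inradius_bounds:
  assumes U: "U \<subseteq> cball 0 r0" and r: "r > 0" "ball z r \<subseteq> U"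
  shows "ball z (inradius z U) \<subseteq> U" "r \<le> inradius z U" "inradius z U \<le> r0"
proof -
  let ?S = "{r. r > 0 \<and> ball z r \<subseteq> U}"
  have up: "s \<le> r0" if "s \<in> ?S" for s
  proof -
    have "ball z s \<subseteq> cball 0 r0" "s > 0" using that U by auto
    then have "dist z 0 + s \<le> r0" by (simp add: ball_subset_cball_iff)
    then show ?thesis using zero_le_dist[of z 0] by linarith
  qed
  have ne: "?S \<noteq> {}" using r by blast
  have bdd: "bdd_above ?S" using up by (intro bdd_aboveI[of _ r0])
  show "r \<le> inradius z U" unfolding inradius_def using r bdd by (intro cSup_upper) auto
  show "inradius z U \<le> r0" unfolding inradius_def using ne up by (rule cSup_least)
  show "ball z (inradius z U) \<subseteq> U"
  proof
    fix w assume "w \<in> ball z (inradius z U)"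
    then have "dist z w < Sup ?S" by (simp add: inradius_def)
    then obtain s where "s \<in> ?S" "dist z w < s" using less_cSup_iff[OF ne bdd] by blast
    then show "w \<in> U" by auto
  qed
qed

context polynomial_family
begin

text \<open>The coefficient \<open>a d\<close> may vanish away from \<open>0\<close>, so the degree
  can drop in some fibers; a constant fiber map would contradict \<open>escape\<close>.\<close>

lemma degree_Q_pos:
  assumes t: "t \<in> ball 0 \<delta>"
  shows "degree (Q t) > 0"
proof (rule ccontr)
  assume "\<not> degree (Q t) > 0"
  then obtain c where c: "Q t = [:c:]" using degree_eq_zeroE by blast
  define x where "x = complex_of_real (R + norm c + 1)"
  have nx: "norm x = R + norm c + 1" using R unfolding x_def norm_of_real by simp
  then have "2 * norm x \<le> norm (f t x)" using R norm_ge_zero[of c] by (intro escape[OF t]) linarith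
  then show False using nx R norm_ge_zero[of c] by (simp add: f_eq_Q[OF t] c)
qed

lemma avoids_mono:
  "avoids_periodic_critical q \<epsilon> z \<Longrightarrow> dist z y \<le> \<epsilon>' \<Longrightarrow> avoids_periodic_critical q (\<epsilon> - \<epsilon>') y"
  unfolding avoids_periodic_critical_def by (smt (verit) dist_triangle)

end

section \<open>Inradii along the orbit of a wandering disk\<close>

locale wandering_disk = polynomial_family +
  fixes lam :: complex and x0 :: "complex \<times> complex" and D0 :: "(complex \<times> complex) set"
  assumes lam: "norm lam < 1"
    and disk: "vertical_disk_centered (ball 0 \<delta>) x0 D0"
    and wand: "wandering (ball 0 \<delta>) lam f D0"
begin

definition t :: "nat \<Rightarrow> complex" where "t n = fst ((skew lam f ^^ n) x0)"
definition z :: "nat \<Rightarrow> complex" where "z n = snd ((skew lam f ^^ n) x0)"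
definition V :: "nat \<Rightarrow> complex set" where "V n = snd ` (skew lam f ^^ n) ` D0"
definition \<rho> :: "nat \<Rightarrow> real" where "\<rho> n = inradius (z n) (V n)"

lemma t_eq: "t n = lam ^ n * t 0"
  by (simp add: t_def fst_skew_funpow)

lemma t0_in: "t 0 \<in> ball 0 \<delta>"
  using disk by (simp add: t_def vertical_disk_centered_def)

lemma norm_t_antimono: "m \<le> n \<Longrightarrow> norm (t n) \<le> norm (t m)"
  unfolding t_eq[of n] t_eq[of m] norm_mult norm_power
  using lam by (intro mult_right_mono power_decreasing) auto

lemma t_in: "t n \<in> ball 0 \<delta>"
  using norm_t_antimono[of 0 n] t0_in by simp

lemma t_lim: "t \<longlonglongrightarrow> 0"
proof -
  have "(\<lambda>n. lam ^ n * t 0) \<longlonglongrightarrow> 0" using lam by (intro tendsto_mult_left_zero LIMSEQ_power_zero)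
  moreover have "t = (\<lambda>n. lam ^ n * t 0)" using t_eq by blast
  ultimately show ?thesis by simp
qed

lemma z_Suc: "z (Suc n) = f (t n) (z n)"
  by (simp add: z_def t_def skew_eq)

lemma fst_disk:
  assumes "x \<in> (skew lam f ^^ n) ` D0" shows "fst x = t n"
proof -
  obtain y where y: "y \<in> D0" "x = (skew lam f ^^ n) y" using assms by blast
  then have "fst y = fst x0" using disk unfolding vertical_disk_centered_def by auto
  then show ?thesis unfolding y(2) t_def fst_skew_funpow by simp
qed

lemma V_Suc: "V (Suc n) = f (t n) ` V n"
proof -
  have "V (Suc n) = (\<lambda>x. f (fst x) (snd x)) ` ((skew lam f ^^ n) ` D0)"
    by (auto simp: V_def skew_eq image_iff)
  also have "\<dots> = (\<lambda>x. f (t n) (snd x)) ` ((skew lam f ^^ n) ` D0)"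
    using fst_disk by (intro image_cong) auto
  finally show ?thesis by (simp add: V_def image_image)
qed

lemma not_in_bulging:
  assumes "bulging (ball 0 \<delta>) lam f \<Omega>" "w \<in> V n" shows "(t n, w) \<notin> \<Omega>"
proof -
  obtain x where x: "x \<in> (skew lam f ^^ n) ` D0" "w = snd x" using assms(2) unfolding V_def by blast
  then have "(t n, w) = x" using fst_disk[OF x(1)] by (simp add: prod_eq_iff)
  with x(1) assms(1) wand show ?thesis unfolding wandering_def by blast
qed

text \<open>The whole exterior of radius \<open>R\<close>, over every fiber, belongs to one bulging
  component, which the forward images must miss.\<close>

lemma V_bounded: "V n \<subseteq> cball 0 R"
proof
  fix w assume w: "w \<in> V n"
  obtain \<Omega> where \<Omega>: "bulging (ball 0 \<delta>) lam f \<Omega>" "ball 0 \<delta> \<times> {z. norm z > R} \<subseteq> \<Omega>"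
    using bulging_at_infinity[OF lam] by blast
  have "(t n, w) \<notin> ball 0 \<delta> \<times> {z. norm z > R}" using not_in_bulging[OF \<Omega>(1) w] \<Omega>(2) by blast
  then show "w \<in> cball 0 R" using t_in[of n] by simp
qed

lemma ball_image:
  assumes r: "r > 0" "ball (z n) r \<subseteq> V n"
  shows "ball (z (Suc n)) (norm (lead_coeff (Q (t n))) * r ^ degree (Q (t n))) \<subseteq> V (Suc n)"
    "ball (z (Suc n)) (norm (poly (pderiv (Q (t n))) (z n)) * r / degree (Q (t n))) \<subseteq> V (Suc n)"
proof -
  note * = poly_image_ball[OF degree_Q_pos[OF t_in[of n]] r(1), of "z n"]
  have "poly (Q (t n)) ` ball (z n) r \<subseteq> V (Suc n)"
    unfolding V_Suc f_eq_Q[OF t_in] using r(2) by (rule image_mono)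
  with * show "ball (z (Suc n)) (norm (lead_coeff (Q (t n))) * r ^ degree (Q (t n))) \<subseteq> V (Suc n)"
    "ball (z (Suc n)) (norm (poly (pderiv (Q (t n))) (z n)) * r / degree (Q (t n))) \<subseteq> V (Suc n)"
    unfolding z_Suc f_eq_Q[OF t_in] by blast+
qed

text \<open>Fiber maps are nonconstant, so the covering radius is positive at each step, including
  fibers where the degree drops. This makes every \<open>\<rho> n\<close> positive.\<close>

lemma ex_ball: "\<exists>r>0. ball (z n) r \<subseteq> V n"
proof (induction n)
  case 0
  then show ?case using disk by (auto simp: vertical_disk_centered_def V_def z_def)
next
  case (Suc n)
  then obtain r where r: "r > 0" "ball (z n) r \<subseteq> V n" by blast
  have "lead_coeff (Q (t n)) \<noteq> 0" using degree_Q_pos[OF t_in[of n]] by auto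
  then have "norm (lead_coeff (Q (t n))) * r ^ degree (Q (t n)) > 0" using r by simp
  with ball_image(1)[OF r] show ?case by blast
qed

lemma \<rho>: "ball (z n) (\<rho> n) \<subseteq> V n" "0 < \<rho> n" "\<rho> n \<le> R"
proof -
  obtain r where r: "r > 0" "ball (z n) r \<subseteq> V n" using ex_ball by blast
  note * = inradius_bounds[OF V_bounded[of n] r]
  show "ball (z n) (\<rho> n) \<subseteq> V n" "\<rho> n \<le> R" using * by (auto simp: \<rho>_def)
  show "0 < \<rho> n" using *(2) r(1) by (simp add: \<rho>_def)
qed

lemma \<rho>_ge: "ball (z n) r \<subseteq> V n \<Longrightarrow> r \<le> \<rho> n"
  using inradius_bounds(2)[OF V_bounded[of n], of r "z n"] \<rho>(2)[of n] unfolding \<rho>_def by linarith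

lemma z_bounded: "norm (z n) \<le> R"
proof -
  have "z n \<in> cball 0 R" using \<rho>(1,2)[of n] V_bounded[of n] by (meson centre_in_ball subsetD)
  then show ?thesis by simp
qed

lemma z_in_V: "z n \<in> V n"
  using \<rho>(1,2)[of n] by (meson centre_in_ball subsetD)

lemmas \<rho>_Suc = ball_image[OF \<rho>(2) \<rho>(1), THEN \<rho>_ge]

definition G :: "nat \<Rightarrow> real" where "G n = ln R - ln (\<rho> n)"

lemma G_nonneg: "0 \<le> G n"
proof -
  have "ln (\<rho> n) \<le> ln R" using \<rho>(2,3)[of n] R by (subst ln_le_cancel_iff) auto
  then show ?thesis by (simp add: G_def)
qed

lemma \<rho>_eq: "\<rho> n = R * exp (- G n)"
  using \<rho>(2)[of n] R by (simp add: G_def exp_diff)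

text \<open>Logarithm of the covering radius that survives at critical points. The constant is cut
  off at \<open>0\<close> because the growth lemma requires a nonnegative one.\<close>

lemma G_Suc_general:
  assumes \<alpha>: "\<alpha> > 0" "\<alpha> \<le> norm (a d (t n))"
  shows "G (Suc n) \<le> d * G n + max 0 ((1 - real d) * ln R - ln \<alpha>)"
proof -
  have nz: "a d (t n) \<noteq> 0" using \<alpha> by auto
  have lc: "lead_coeff (Q (t n)) = a d (t n)" "degree (Q (t n)) = d"
    using degree_Q[OF nz] by (auto simp: coeff_Q)
  have "\<alpha> * \<rho> n ^ d \<le> norm (a d (t n)) * \<rho> n ^ d"
    using \<alpha> \<rho>(2)[of n] by (intro mult_right_mono) auto
  also have "\<dots> \<le> \<rho> (Suc n)" using \<rho>_Suc(1)[of n] by (simp add: lc(2) coeff_Q)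
  finally have "ln (\<alpha> * \<rho> n ^ d) \<le> ln (\<rho> (Suc n))"
    using \<alpha>(1) \<rho>(2)[of n] by (subst ln_le_cancel_iff) (auto intro: \<rho>(2))
  then have "ln \<alpha> + d * ln (\<rho> n) \<le> ln (\<rho> (Suc n))"
    using \<alpha>(1) \<rho>(2)[of n] by (simp add: ln_mult_pos ln_realpow)
  then have "G (Suc n) \<le> d * G n + ((1 - real d) * ln R - ln \<alpha>)" by (simp add: G_def algebra_simps)
  then show ?thesis by linarith
qed

text \<open>In \<open>ln (2 * real d)\<close> the \<open>d\<close> is the denominator of the
  covering radius, and the \<open>2\<close> is the margin left for replacing the derivative along an
  orbit of \<open>f 0\<close> by the derivative along the true orbit.\<close>

lemma G_Suc_derivative:
  assumes D: "exp (- b) / 2 \<le> norm (poly (pderiv (Q (t n))) (z n))" and nz: "a d (t n) \<noteq> 0"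
  shows "G (Suc n) \<le> G n + (b + ln (2 * real d))"
proof -
  have "exp (- b) * \<rho> n / (2 * real d) = (exp (- b) / 2) * \<rho> n / d" by simp
  also have "\<dots> \<le> norm (poly (pderiv (Q (t n))) (z n)) * \<rho> n / d"
    using D \<rho>(2)[of n] by (intro divide_right_mono mult_right_mono) auto
  also have "\<dots> \<le> \<rho> (Suc n)" using \<rho>_Suc(2)[of n] unfolding degree_Q[OF nz] .
  finally have "ln (exp (- b) * \<rho> n / (2 * real d)) \<le> ln (\<rho> (Suc n))"
    using \<rho>(2)[of n] d by (subst ln_le_cancel_iff) (auto intro!: \<rho>(2) divide_pos_pos)
  then have "- b + ln (\<rho> n) - ln (2 * real d) \<le> ln (\<rho> (Suc n))"
    using \<rho>(2)[of n] d by (simp add: ln_div ln_mult_pos)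
  then show ?thesis by (simp add: G_def)
qed

text \<open>During the \<open>m\<close> steps after time \<open>N\<close> the orbit is shadowed by the orbit of \<open>z N\<close> under
  \<open>f 0\<close>. Only the boundedly many passages closest to critical points are estimated by the
  crude \<open>d\<close>-th power bound, all others by the derivative.\<close>

lemma G_window_bound:
  fixes N m :: nat and K Th \<epsilon> \<alpha> :: real
  assumes K: "K \<ge> 1" and lip: "\<forall>t z y. norm t \<le> \<delta>/2 \<longrightarrow> norm z \<le> R + 1 \<longrightarrow> norm y \<le> R + 1 \<longrightarrow>
     dist (f t z) (f 0 y) \<le> K * (norm t + dist z y) \<and>
     dist (poly (pderiv (Q t)) z) (poly (pderiv (Q 0)) y) \<le> K * (norm t + dist z y)"
    and Th: "Th \<ge> 0" and orb: "\<forall>n y. (\<forall>l. Suc l < n \<longrightarrow> y (Suc l) = poly (Q 0) (y l)) \<longrightarrow>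
     (\<forall>l<n. norm (y l) \<le> R + 1) \<longrightarrow> (\<forall>l<n. avoids_periodic_critical (Q 0) (\<epsilon>/2) (y l)) \<longrightarrow>
     (\<exists>E b. E \<subseteq> {..<n} \<and> card E \<le> degree (Q 0) \<and>
       (\<forall>l\<in>{..<n}-E. 0 \<le> b l \<and> exp (- b l) \<le> norm (poly (pderiv (Q 0)) (y l))) \<and> sum b ({..<n}-E) \<le> Th * real n)"
    and \<alpha>: "\<alpha> > 0" "\<And>n. N \<le> n \<Longrightarrow> \<alpha> \<le> norm (a d (t n))"
    and tN: "norm (t N) \<le> \<delta>/2" and av: "\<And>n. N \<le> n \<Longrightarrow> avoids_periodic_critical (Q 0) \<epsilon> (z n)"
    and err: "(2*K)^m * norm (t N) \<le> 1" "(2*K)^m * norm (t N) \<le> \<epsilon>/2"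
      "2 * K * ((2*K)^m * norm (t N)) \<le> exp (- Th * m) / 2"
  shows "G (N + m) \<le> d ^ d * (G N + (Th + ln (2 * real d)) * m + d * max 0 ((1 - real d) * ln R - ln \<alpha>))"
proof -
  define y where "y l = (f 0 ^^ l) (z N)" for l
  define a0 where "a0 = max 0 ((1 - real d) * ln R - ln \<alpha>)"
  have a0: "0 \<le> a0" by (simp add: a0_def)
  have tl: "norm (t (N + l)) \<le> norm (t N)" for l by (rule norm_t_antimono) simp
  have pw: "(2*K)^l * norm (t N) \<le> (2*K)^m * norm (t N)" if "l \<le> m" for l
    using K that by (intro mult_right_mono power_increasing) auto
  have tpow: "norm (t N) \<le> (2*K)^l * norm (t N)" for l
    using mult_right_mono[OF one_le_power[of "2*K" l], of "norm (t N)"] K by simp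
  \<comment> \<open>The true orbit stays within \<open>R\<close> and the shadowing error within
    \<open>1\<close>; this is why the constants are taken for radius \<open>R + 1\<close>.\<close>
  have ybd: "norm (y l) \<le> R + 1" if "l \<le> m" "dist (z (N + l)) (y l) \<le> (2*K)^l * norm (t N)" for l
  proof -
    have "norm (y l) \<le> norm (z (N + l)) + dist (z (N + l)) (y l)"
      by (metis dist_commute dist_norm norm_triangle_sub)
    with that pw[OF that(1)] err(1) z_bounded[of "N+l"] show ?thesis by linarith
  qed
  \<comment> \<open>A step turns an error into at most \<open>K\<close> times the sum of that error
    and \<open>norm (t (N + l))\<close>. Both summands are bounded by
    \<open>(2*K)^l * norm (t N)\<close>, so the error grows by the factor
    \<open>2 * K\<close>.\<close>
  have close: "dist (z (N + l)) (y l) \<le> (2*K)^l * norm (t N)" if "l \<le> m" for l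
    using that
  proof (induction l)
    case 0 then show ?case by (simp add: y_def)
  next
    case (Suc l)
    then have IH: "dist (z (N + l)) (y l) \<le> (2*K)^l * norm (t N)" and l: "l \<le> m" by auto
    have "norm (t (N+l)) \<le> \<delta>/2" "norm (z (N+l)) \<le> R + 1" "norm (y l) \<le> R + 1"
      using tl[of l] tN z_bounded[of "N+l"] ybd[OF l IH] by auto
    then have "dist (f (t (N+l)) (z (N+l))) (f 0 (y l)) \<le> K * (norm (t (N+l)) + dist (z (N+l)) (y l))"
      using lip by blast
    also have "\<dots> \<le> K * ((2*K)^l * norm (t N) + (2*K)^l * norm (t N))"
      using K IH tl[of l] tpow[of l] by (intro mult_left_mono add_mono) auto
    finally show ?case by (simp add: z_Suc y_def algebra_simps)
  qed
  have ybd': "norm (y l) \<le> R + 1" if "l < m" for l using ybd close that by simp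
  have yav: "avoids_periodic_critical (Q 0) (\<epsilon>/2) (y l)" if "l < m" for l
  proof -
    have "dist (z (N + l)) (y l) \<le> \<epsilon>/2" using close[of l] pw[of l] err(2) that by linarith
    from avoids_mono[OF av this] show ?thesis by (simp add: field_simps)
  qed
  have yorb: "y (Suc l) = poly (Q 0) (y l)" for l by (simp add: y_def f0_eq_Q)
  have degQ0: "degree (Q 0) = d" by (rule degree_Q[OF lead0])
  have "\<exists>E b. E \<subseteq> {..<m} \<and> card E \<le> d \<and>
       (\<forall>l\<in>{..<m}-E. 0 \<le> b l \<and> exp (- b l) \<le> norm (poly (pderiv (Q 0)) (y l))) \<and> sum b ({..<m}-E) \<le> Th * real m"
    using orb[THEN spec, THEN spec, of m y] yorb ybd' yav unfolding degQ0 by blast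
  then obtain E b where E: "E \<subseteq> {..<m}" "card E \<le> d"
    and b: "\<forall>l\<in>{..<m}-E. 0 \<le> b l \<and> exp (- b l) \<le> norm (poly (pderiv (Q 0)) (y l))"
    and sb: "sum b ({..<m}-E) \<le> Th * real m" by (elim exE conjE)
  define b' where "b' l = b l + ln (2 * real d)" for l
  have ln2d: "0 \<le> ln (2 * real d)" using d by simp
  have off: "0 \<le> b' l \<and> G (N + Suc l) \<le> G (N + l) + b' l" if l: "l < m" "l \<notin> E" for l
  proof -
    have bl: "0 \<le> b l" "exp (- b l) \<le> norm (poly (pderiv (Q 0)) (y l))" using b l by auto
    \<comment> \<open>No single loss exceeds the total \<open>Th * m\<close>, so off
      \<open>E\<close> every derivative along \<open>y\<close> is at least
      \<open>exp (- Th * m)\<close>. By \<open>err(3)\<close> the deviation from the true orbit is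
      at most half of that.\<close>
    have "b l \<le> sum b ({..<m}-E)" using b l by (intro member_le_sum) auto
    then have "exp (- Th * m) \<le> exp (- b l)" using sb by simp
    moreover have "dist (poly (pderiv (Q (t (N+l)))) (z (N+l))) (poly (pderiv (Q 0)) (y l))
        \<le> 2 * K * ((2*K)^m * norm (t N))"
    proof -
      have "norm (t (N+l)) \<le> \<delta>/2" "norm (z (N+l)) \<le> R + 1"
        using tl[of l] tN z_bounded[of "N+l"] by auto
      then have "dist (poly (pderiv (Q (t (N+l)))) (z (N+l))) (poly (pderiv (Q 0)) (y l))
        \<le> K * (norm (t (N+l)) + dist (z (N+l)) (y l))" using lip ybd'[OF l(1)] by blast
      also have "\<dots> \<le> K * ((2*K)^m * norm (t N) + (2*K)^m * norm (t N))"
      proof (intro mult_left_mono add_mono)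
        show "norm (t (N + l)) \<le> (2*K)^m * norm (t N)" using tl[of l] tpow[of m] by linarith
        show "dist (z (N+l)) (y l) \<le> (2*K)^m * norm (t N)" using close[of l] pw[of l] l by linarith
      qed (use K in simp)
      finally show ?thesis by (simp add: mult_ac power_mult_distrib)
    qed
    moreover have "norm (poly (pderiv (Q 0)) (y l)) \<le> norm (poly (pderiv (Q (t (N+l)))) (z (N+l)))
        + dist (poly (pderiv (Q (t (N+l)))) (z (N+l))) (poly (pderiv (Q 0)) (y l))"
      by (metis dist_commute dist_norm norm_triangle_sub)
    ultimately have "exp (- b l) / 2 \<le> norm (poly (pderiv (Q (t (N+l)))) (z (N+l)))"
      using bl(2) err(3) by linarith
    moreover have "a d (t (N+l)) \<noteq> 0" using \<alpha>(1) \<alpha>(2)[of "N+l"] by auto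
    ultimately have "G (Suc (N + l)) \<le> G (N + l) + (b l + ln (2 * real d))" by (rule G_Suc_derivative)
    then show ?thesis using bl ln2d by (simp add: b'_def)
  qed
  define c where "c = card (E \<inter> {..<m})"
  have c: "c \<le> d" using E by (simp add: c_def Int_absorb2)
  have "G (N + m) \<le> real d ^ c * (G (N + 0) + sum b' ({..<m} - E) + c * a0)"
    unfolding c_def
  proof (rule growth_with_exceptions[where G = "\<lambda>l. G (N + l)"])
    show "G (N + Suc l) \<le> real d * G (N + l) + a0" if "l < m" for l
      using G_Suc_general[OF \<alpha>(1) \<alpha>(2), of "N+l"] by (simp add: a0_def)
  qed (use d a0 off in auto)
  also have "\<dots> \<le> real d ^ d * (G N + (Th + ln (2 * real d)) * m + d * a0)"
  proof (intro mult_mono power_increasing add_mono)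
    have "sum b' ({..<m} - E) = sum b ({..<m} - E) + card ({..<m} - E) * ln (2 * real d)"
      by (simp add: b'_def sum.distrib)
    also have "card ({..<m} - E) * ln (2 * real d) \<le> m * ln (2 * real d)"
      using ln2d card_mono[of "{..<m}" "{..<m} - E"] by (intro mult_right_mono) auto
    finally show "sum b' ({..<m} - E) \<le> (Th + ln (2 * real d)) * m" using sb by (simp add: algebra_simps)
    have "0 \<le> sum b' ({..<m} - E)" using off by (intro sum_nonneg) auto
    then show "0 \<le> G (N + 0) + sum b' ({..<m} - E) + c * a0" using G_nonneg[of N] a0 by simp
  qed (use d c a0 in \<open>auto intro: mult_right_mono\<close>)
  finally show ?thesis by (simp add: a0_def)
qed

text \<open>The width \<eta> varies with \<open>c\<close>, but there are finitely many critical
  points and \<open>t\<close> tends to \<open>0\<close>. Once the fiber parameter is below \<eta>, a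
  visit to \<open>ball c \<epsilon>\<close> would enter a bulging component.\<close>

lemma eventually_avoids:
  assumes \<epsilon>: "\<And>c k. poly (pderiv (Q 0)) c = 0 \<Longrightarrow> k > 0 \<Longrightarrow> (f 0 ^^ k) c = c \<Longrightarrow>
      \<exists>\<eta>>0. \<exists>\<Omega>. bulging (ball 0 \<delta>) lam f \<Omega> \<and> ball 0 \<eta> \<times> ball c \<epsilon> \<subseteq> \<Omega>"
    and fin: "finite {c. poly (pderiv (Q 0)) c = 0}"
  shows "\<forall>\<^sub>F n in sequentially. avoids_periodic_critical (Q 0) \<epsilon> (z n)"
proof -
  define A where "A = {c. poly (pderiv (Q 0)) c = 0 \<and> (\<exists>k>0. (f 0 ^^ k) c = c)}"
  have "finite A" using fin by (rule rev_finite_subset) (auto simp: A_def)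
  moreover have "\<forall>\<^sub>F n in sequentially. \<epsilon> \<le> dist (z n) c" if c: "c \<in> A" for c
  proof -
    obtain \<eta> \<Omega> where \<eta>: "\<eta> > 0" and \<Omega>: "bulging (ball 0 \<delta>) lam f \<Omega>" "ball 0 \<eta> \<times> ball c \<epsilon> \<subseteq> \<Omega>"
      using c \<epsilon> unfolding A_def by blast
    from tendstoD[OF t_lim \<eta>] show ?thesis
    proof eventually_elim
      case (elim n)
      have "(t n, z n) \<notin> ball 0 \<eta> \<times> ball c \<epsilon>" using not_in_bulging[OF \<Omega>(1) z_in_V] \<Omega>(2) by blast
      with elim show ?case by (auto simp: dist_commute)
    qed
  qed
  ultimately have "\<forall>\<^sub>F n in sequentially. \<forall>c\<in>A. \<epsilon> \<le> dist (z n) c"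
    by (intro eventually_ball_finite ballI)
  then show ?thesis
  proof eventually_elim
    case (elim n)
    show ?case unfolding avoids_periodic_critical_def f0_eq_Q[symmetric]
      using elim unfolding A_def by blast
  qed
qed

end

section \<open>Choice of the constants and conclusion\<close>

context polynomial_family
begin

text \<open>The order of quantifiers is the point: \<epsilon> is fixed before \<open>lam\<close>,
  because \<open>Th\<close> and through it the bound on \<open>norm lam\<close> depend on
  \<epsilon>. Only the fiber width \<eta> may depend on \<open>lam\<close>.\<close>

lemma superattracting_uniform_radius:
  "\<exists>\<epsilon>>0. \<forall>lam. norm lam < 1 \<longrightarrow> (\<forall>c k. poly (pderiv (Q 0)) c = 0 \<longrightarrow> k > 0 \<longrightarrow> (f 0 ^^ k) c = c \<longrightarrow>
      (\<exists>\<eta>>0. \<exists>\<Omega>. bulging (ball 0 \<delta>) lam f \<Omega> \<and> ball 0 \<eta> \<times> ball c \<epsilon> \<subseteq> \<Omega>))"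
proof -
  define A where "A = {c. poly (pderiv (Q 0)) c = 0 \<and> (\<exists>k>0. (f 0 ^^ k) c = c)}"
  have "pderiv (Q 0) \<noteq> 0" using degree_Q[OF lead0] d by (auto simp: pderiv_eq_0_iff)
  then have finA: "finite A"
    by (rule rev_finite_subset[OF poly_roots_finite]) (auto simp: A_def)
  have "\<forall>c\<in>A. \<exists>\<epsilon>>0. \<exists>k>0. (f 0 ^^ k) c = c \<and> (\<forall>z\<in>ball c \<epsilon>. dist ((f 0 ^^ k) z) c \<le> 1/2 * dist z c)"
    using superattracting_contraction unfolding A_def by blast
  from bchoice[OF this] obtain e where
    e: "\<forall>c\<in>A. e c > 0 \<and> (\<exists>k>0. (f 0 ^^ k) c = c \<and> (\<forall>z\<in>ball c (e c). dist ((f 0 ^^ k) z) c \<le> 1/2 * dist z c))" ..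
  define \<epsilon> where "\<epsilon> = Min (insert 1 (e ` A))"
  have \<epsilon>: "\<epsilon> > 0" "\<And>c. c \<in> A \<Longrightarrow> \<epsilon> \<le> e c"
    using finA e by (auto simp: \<epsilon>_def)
  have "\<exists>\<eta>>0. \<exists>\<Omega>. bulging (ball 0 \<delta>) lam f \<Omega> \<and> ball 0 \<eta> \<times> ball c \<epsilon> \<subseteq> \<Omega>"
    if lam: "norm lam < 1" and c: "poly (pderiv (Q 0)) c = 0" "k > 0" "(f 0 ^^ k) c = c" for lam c k
  proof -
    have cA: "c \<in> A" using c by (auto simp: A_def)
    then obtain k' where k': "k' > 0" "(f 0 ^^ k') c = c"
      "\<And>z. z \<in> ball c (e c) \<Longrightarrow> dist ((f 0 ^^ k') z) c \<le> 1/2 * dist z c" using e by blast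
    have "ball c \<epsilon> \<subseteq> ball c (e c)" using \<epsilon>(2)[OF cA] by (rule subset_ball)
    then show ?thesis
      using k'(3) by (intro bulging_at_superattracting[OF c(1) k'(1,2) \<epsilon>(1) _ lam]) blast
  qed
  note main = this
  show ?thesis
  proof (rule exI[of _ \<epsilon>], intro conjI allI impI)
    show "\<epsilon> > 0" by (rule \<epsilon>(1))
  qed (rule main)
qed

lemma lead_coeff_bounded_below:
  "\<exists>\<eta>>0. \<exists>\<alpha>>0. \<forall>t. norm t < \<eta> \<longrightarrow> \<alpha> \<le> norm (a d t)"
proof -
  have "isCont (a d) 0"
    using holomorphic_on_imp_continuous_on[OF hol[OF order_refl]] \<delta>
    by (auto simp: continuous_on_eq_continuous_at)
  then obtain \<eta> where \<eta>: "\<eta> > 0" "\<And>t. dist t 0 < \<eta> \<Longrightarrow> dist (a d t) (a d 0) < norm (a d 0) / 2"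
    unfolding continuous_at_eps_delta using lead0 by (metis half_gt_zero zero_less_norm_iff)
  have "norm (a d 0) / 2 \<le> norm (a d t)" if "norm t < \<eta>" for t
  proof -
    have "norm (a d 0) \<le> norm (a d t) + dist (a d t) (a d 0)"
      by (metis dist_commute dist_norm norm_triangle_sub)
    with \<eta>(2)[of t] that show ?thesis by simp
  qed
  with \<eta>(1) lead0 show ?thesis by (intro exI[of _ \<eta>] conjI exI[of _ "norm (a d 0) / 2"]) auto
qed

theorem inradius_decay:
  "\<exists>lam2>0. \<forall>lam. norm lam < 1 \<and> norm lam < lam2 \<longrightarrow>
     (\<forall>x0 D0. vertical_disk_centered (ball 0 \<delta>) x0 D0 \<longrightarrow> wandering (ball 0 \<delta>) lam f D0 \<longrightarrow>
      (\<lambda>n. norm lam ^ n /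
            inradius (snd ((skew lam f ^^ n) x0)) (snd ` ((skew lam f ^^ n) ` D0))) \<longlonglongrightarrow> 0)"
proof -
  obtain \<epsilon> where \<epsilon>: "\<epsilon> > 0" "\<forall>lam. norm lam < 1 \<longrightarrow> (\<forall>c k. poly (pderiv (Q 0)) c = 0 \<longrightarrow> k > 0 \<longrightarrow> (f 0 ^^ k) c = c \<longrightarrow>
      (\<exists>\<eta>>0. \<exists>\<Omega>. bulging (ball 0 \<delta>) lam f \<Omega> \<and> ball 0 \<eta> \<times> ball c \<epsilon> \<subseteq> \<Omega>))"
    using superattracting_uniform_radius by (elim exE conjE)
  obtain \<eta>0 \<alpha> where \<eta>0: "\<eta>0 > 0" and \<alpha>: "\<alpha> > 0" "\<And>t. norm t < \<eta>0 \<Longrightarrow> \<alpha> \<le> norm (a d t)"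
    using lead_coeff_bounded_below by blast
  obtain K where K: "K \<ge> 1" and lip: "\<forall>t z y. norm t \<le> \<delta>/2 \<longrightarrow> norm z \<le> R + 1 \<longrightarrow> norm y \<le> R + 1 \<longrightarrow>
     dist (f t z) (f 0 y) \<le> K * (norm t + dist z y) \<and>
     dist (poly (pderiv (Q t)) z) (poly (pderiv (Q 0)) y) \<le> K * (norm t + dist z y)"
    using lipschitz_constant[of "R + 1"] by (elim exE conjE)
  have degQ0: "degree (Q 0) \<ge> 2" using degree_Q[OF lead0] d by simp
  \<comment> \<open>Half of \<epsilon>, because the comparison orbit may be closer to a critical
    point than the true one by the shadowing error, at most \<epsilon>/2.\<close>
  have e2: "\<epsilon>/2 > 0" using \<epsilon>(1) by simp
  obtain Th where Th: "Th \<ge> 0" and orb: "\<forall>n y. (\<forall>l. Suc l < n \<longrightarrow> y (Suc l) = poly (Q 0) (y l)) \<longrightarrow>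
     (\<forall>l<n. norm (y l) \<le> R + 1) \<longrightarrow> (\<forall>l<n. avoids_periodic_critical (Q 0) (\<epsilon>/2) (y l)) \<longrightarrow>
     (\<exists>E b. E \<subseteq> {..<n} \<and> card E \<le> degree (Q 0) \<and>
       (\<forall>l\<in>{..<n}-E. 0 \<le> b l \<and> exp (- b l) \<le> norm (poly (pderiv (Q 0)) (y l))) \<and> sum b ({..<n}-E) \<le> Th * real n)"
    using orbit_derivative_lower_bound[OF degQ0 e2, of "R + 1"] by (elim exE conjE)
  define a0 where "a0 = max 0 ((1 - real d) * ln R - ln \<alpha>)"
  define T where "T = d ^ d"
  define A where "A = Th + ln (2 * real d) + d * a0"
  define h where "h = 2 * T"
  define Lam where "Lam = T * (2 * T * A + 1 + A)"
  \<comment> \<open>Over a window of length at most \<open>h * N\<close> the error is amplified by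
    at most \<open>(2 * K) ^ (h * N)\<close> and must stay below derivatives as small as
    \<open>exp (- Th * h * N)\<close>. The requirement \<open>norm lam * M < 1\<close> lets
    \<open>norm lam ^ N\<close> beat both; \<open>Lam\<close> is the slope from the window
    lemma.\<close>
  define M where "M = (2 * K) ^ h * exp (Th * h)"
  have T: "1 \<le> T" using d by (simp add: T_def)
  have ln2d: "0 \<le> ln (2 * real d)" using d by simp
  have a0: "0 \<le> a0" by (simp add: a0_def)
  have A: "0 \<le> A" using Th ln2d a0 by (simp add: A_def)
  have M: "M > 0" using K by (simp add: M_def)
  define lam2 where "lam2 = min (exp (- Lam)) (1 / M)"
  have "lam2 > 0" using M by (simp add: lam2_def)
  moreover have "(\<lambda>n. norm lam ^ n /
            inradius (snd ((skew lam f ^^ n) x0)) (snd ` ((skew lam f ^^ n) ` D0))) \<longlonglongrightarrow> 0"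
    if lam: "norm lam < 1" "norm lam < lam2" and x0: "vertical_disk_centered (ball 0 \<delta>) x0 D0"
      "wandering (ball 0 \<delta>) lam f D0" for lam x0 D0
  proof -
    note lam_lt = lam(2)
    interpret wandering_disk \<delta> R d a f lam x0 D0
      by unfold_locales (rule lam(1) x0)+
    have "pderiv (Q 0) \<noteq> 0" using degQ0 by (auto simp: pderiv_eq_0_iff)
    then have fin: "finite {c. poly (pderiv (Q 0)) c = 0}" by (rule poly_roots_finite)
    have ev1: "\<forall>\<^sub>F n in sequentially. avoids_periodic_critical (Q 0) \<epsilon> (z n)"
      using \<epsilon>(2)[rule_format, OF lam] fin by (rule eventually_avoids)
    have ev2: "\<forall>\<^sub>F n in sequentially. norm (t n) < min \<eta>0 (\<delta>/2)"
      using tendstoD[OF t_lim, of "min \<eta>0 (\<delta>/2)"] \<eta>0 \<delta> by simp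
    have lamM: "norm lam * M < 1" using lam_lt M by (simp add: lam2_def less_divide_eq)
    \<comment> \<open>The value \<open>1/2\<close> is for the comparison of derivatives and also
      gives error at most \<open>1\<close>; \<epsilon>/2 keeps the comparison orbit away from the
      superattracting points.\<close>
    define \<kappa> where "\<kappa> = min (1/2) (\<epsilon>/2)"
    have \<kappa>: "\<kappa> > 0" using \<epsilon> by (simp add: \<kappa>_def)
    have "(\<lambda>n. (2 * K * norm (t 0)) * (norm lam * M) ^ n) \<longlonglongrightarrow> (2 * K * norm (t 0)) * 0"
      using lamM M by (intro tendsto_mult tendsto_const LIMSEQ_power_zero) (simp add: abs_mult)
    then have ev3: "\<forall>\<^sub>F n in sequentially. (2 * K * norm (t 0)) * (norm lam * M) ^ n < \<kappa>"
      using \<kappa> by (intro order_tendstoD(2)[of _ "(2 * K * norm (t 0)) * 0"]) auto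
    from eventually_conj[OF ev1 eventually_conj[OF ev2 ev3]] obtain N1 where
      N1: "\<And>n. N1 \<le> n \<Longrightarrow> avoids_periodic_critical (Q 0) \<epsilon> (z n) \<and> norm (t n) < min \<eta>0 (\<delta>/2)
          \<and> (2 * K * norm (t 0)) * (norm lam * M) ^ n < \<kappa>"
      unfolding eventually_sequentially by blast
    define N0 where "N0 = max 1 N1"
    have "\<forall>\<^sub>F n in sequentially. G n \<le> T * (2 * T * A + 1 + A) * n"
    proof (rule window_growth_imp_linear[OF T A _ G_nonneg])
      show "1 \<le> N0" by (simp add: N0_def)
      fix N n assume N: "N0 \<le> N" "N \<le> n" "n \<le> 2 * T * N"
      have N1N: "N1 \<le> N" "1 \<le> N" using N by (auto simp: N0_def)
      define m where "m = n - N"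
      have m: "n = N + m" "m \<le> h * N" using N by (auto simp: m_def h_def)
      have mn: "1 \<le> n" using N1N N by simp
      define r where "r = (2*K)^m * norm (t N)"
      have r0: "0 \<le> r" using K by (simp add: r_def)
      have key: "2 * K * r * exp (Th * m) < \<kappa>"
      proof -
        have "r * exp (Th * m) \<le> ((2*K)^(h*N) * norm (t N)) * exp (Th * (h * N))"
          unfolding r_def
        proof (intro mult_mono power_increasing)
          show "exp (Th * real m) \<le> exp (Th * real (h * N))"
            using m(2) Th by (simp only: exp_le_cancel_iff) (intro mult_left_mono, auto simp flip: of_nat_mult)
        qed (use K m(2) in auto)
        also have "\<dots> = norm (t 0) * (norm lam * M) ^ N"
        proof -
          have "exp (Th * real (h * N)) = exp (Th * h) ^ N"
            by (simp add: exp_of_nat_mult[symmetric] mult_ac)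
          moreover have "norm (t N) = norm lam ^ N * norm (t 0)"
            by (subst t_eq) (simp add: norm_mult norm_power)
          ultimately show ?thesis by (simp add: M_def power_mult_distrib power_mult)
        qed
        finally have "2 * K * (r * exp (Th * m)) \<le> 2 * K * (norm (t 0) * (norm lam * M) ^ N)"
          using K by (intro mult_left_mono) auto
        also have "\<dots> < \<kappa>" using N1[OF N1N(1)] by (simp add: mult_ac)
        finally show ?thesis by (simp add: mult_ac)
      qed
      have rk: "2 * K * r \<le> \<kappa>" "r \<le> \<kappa>"
      proof -
        have "(2 * K * r) * 1 \<le> (2 * K * r) * exp (Th * m)"
          using K r0 Th by (intro mult_left_mono) auto
        with key show 1: "2 * K * r \<le> \<kappa>" by linarith
        have "1 * r \<le> (2 * K) * r" using K r0 by (intro mult_right_mono) auto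
        with 1 show "r \<le> \<kappa>" by linarith
      qed
      have err3: "2 * K * r \<le> exp (- Th * m) / 2"
      proof -
        have "(2 * K * r) * exp (Th * m) \<le> 1/2" using key by (simp add: \<kappa>_def)
        then have "2 * K * r \<le> (1/2) / exp (Th * m)" by (subst le_divide_eq) simp
        then show ?thesis by (simp add: exp_minus field_simps)
      qed
      have "G (N + m) \<le> d ^ d * (G N + (Th + ln (2 * real d)) * m + d * max 0 ((1 - real d) * ln R - ln \<alpha>))"
      proof (rule G_window_bound[OF K lip Th orb \<alpha>(1)])
        show "\<alpha> \<le> norm (a d (t n))" if "N \<le> n" for n
          using N1[of n] N1N that by (intro \<alpha>(2)) auto
        show "norm (t N) \<le> \<delta>/2" using N1[OF N1N(1)] by simp
        show "avoids_periodic_critical (Q 0) \<epsilon> (z n)" if "N \<le> n" for n using N1[of n] N1N that by simp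
        show "(2*K)^m * norm (t N) \<le> 1" "(2*K)^m * norm (t N) \<le> \<epsilon>/2"
          using rk(2) unfolding r_def[symmetric] by (auto simp: \<kappa>_def)
        show "2 * K * ((2*K)^m * norm (t N)) \<le> exp (- Th * m) / 2" using err3 unfolding r_def .
      qed
      also have "\<dots> = T * (G N + ((Th + ln (2 * real d)) * m + d * a0))" by (simp add: T_def a0_def add_ac)
      also have "\<dots> \<le> T * (G N + A * n)"
      proof (intro mult_left_mono add_left_mono)
        have "(Th + ln (2 * real d)) * m \<le> (Th + ln (2 * real d)) * n" using m(1) Th ln2d by (intro mult_left_mono) auto
        \<comment> \<open>The cost of the exceptional times does not grow with the window, so
          \<open>1 \<le> n\<close> absorbs it into the linear term.\<close>
        moreover have "(d * a0) * 1 \<le> (d * a0) * n" using a0 mn by (intro mult_left_mono) auto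
        ultimately show "(Th + ln (2 * real d)) * m + d * a0 \<le> A * n" by (simp add: A_def algebra_simps)
      qed simp
      finally show "G n \<le> T * (G N + A * n)" unfolding m(1) .
    qed
    then have evG: "\<forall>\<^sub>F n in sequentially. G n \<le> Lam * n" by (simp add: Lam_def)
    \<comment> \<open>Linear growth of \<open>G\<close> means
      \<open>\<rho> n \<ge> R * exp (- Lam * n)\<close>, so the quotient is eventually dominated by
      a geometric sequence of ratio \<open>q\<close>.\<close>
    define q where "q = norm lam * exp Lam"
    have q: "0 \<le> q" "q < 1"
    proof -
      have "norm lam * exp Lam < exp (- Lam) * exp Lam" using lam_lt by (intro mult_strict_right_mono) (auto simp: lam2_def)
      then show "q < 1" by (simp add: q_def exp_minus)
    qed (simp add: q_def)
    have ev: "\<forall>\<^sub>F n in sequentially. norm (norm lam ^ n / \<rho> n) \<le> q ^ n / R"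
      using evG
    proof eventually_elim
      case (elim n)
      have "R * exp (- (Lam * n)) \<le> \<rho> n" unfolding \<rho>_eq using elim R by simp
      then have "norm lam ^ n / \<rho> n \<le> norm lam ^ n / (R * exp (- (Lam * n)))"
        using R by (intro divide_left_mono) (auto intro: mult_pos_pos \<rho>(2))
      also have "\<dots> = q ^ n / R"
        by (simp add: q_def power_mult_distrib exp_minus exp_of_nat2_mult field_simps)
      finally show ?case using \<rho>(2)[of n] by simp
    qed
    have "(\<lambda>n. q ^ n / R) \<longlonglongrightarrow> 0 / R"
      using q R by (intro tendsto_divide LIMSEQ_power_zero tendsto_const) auto
    then have "(\<lambda>n. norm lam ^ n / \<rho> n) \<longlonglongrightarrow> 0"
      by (intro Lim_null_comparison[OF ev]) simp
    then show ?thesis by (simp add: \<rho>_def z_def V_def)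
  qed
  ultimately show ?thesis by (intro exI[of _ lam2] conjI allI impI) auto
qed

end

theorem proposition5p5:
  fixes \<delta> :: real and d :: nat
    and a :: "nat \<Rightarrow> complex \<Rightarrow> complex"
    and f :: "complex \<Rightarrow> complex \<Rightarrow> complex"
  defines "\<Delta> \<equiv> ball (0::complex) \<delta>"
  assumes "\<delta> > 0"
    and "d \<ge> 2"
    and "\<And>i. i \<le> d \<Longrightarrow> a i holomorphic_on \<Delta>"
    and "a d 0 \<noteq> 0"
    and "\<And>t z. t \<in> \<Delta> \<Longrightarrow> f t z = (\<Sum>i\<le>d. a i t * z ^ i)"
    and "\<exists>R>0. \<forall>t\<in>\<Delta>. \<forall>z. norm z > R \<longrightarrow> norm (f t z) \<ge> 2 * norm z"
  shows "\<exists>lam2>0. \<forall>lam::complex. 0 < norm lam \<and> norm lam < 1 \<and> norm lam < lam2 \<longrightarrow>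
    (\<forall>x0 D0. vertical_Fatou_disk_centered \<Delta> lam f x0 D0 \<and> wandering \<Delta> lam f D0 \<longrightarrow>
      (\<lambda>n. norm lam ^ n /
            inradius (snd ((skew lam f ^^ n) x0)) (snd ` ((skew lam f ^^ n) ` D0)))
        \<longlonglongrightarrow> 0)"
proof -
  obtain R where R: "R > 0" "\<forall>t\<in>\<Delta>. \<forall>z. norm z > R \<longrightarrow> norm (f t z) \<ge> 2 * norm z"
    using assms(7) by blast
  interpret polynomial_family \<delta> R d a f
    using assms(2-6) R unfolding \<Delta>_def by unfold_locales auto
  obtain lam2 where "lam2 > 0" and decay: "\<And>lam x0 D0. norm lam < 1 \<Longrightarrow> norm lam < lam2 \<Longrightarrow>
      vertical_disk_centered \<Delta> x0 D0 \<Longrightarrow> wandering \<Delta> lam f D0 \<Longrightarrow>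
      (\<lambda>n. norm lam ^ n /
            inradius (snd ((skew lam f ^^ n) x0)) (snd ` ((skew lam f ^^ n) ` D0))) \<longlonglongrightarrow> 0"
    using inradius_decay unfolding \<Delta>_def by blast
  then show ?thesis
    unfolding vertical_Fatou_disk_centered_def by blast
qed

end
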